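(* Let $\nu$ be a positive integer and, for $k=1,\dots,\nu$, let $N_k=n_k+n_{k+1}+\dots+n_\nu$. Then for every non-negative integer $L$, \begin{align*} \sum_{\substack{i,m,n_1,\dots,n_\nu\geq 0,\\ i+m \equiv N_1+N_2+\dots + N_\nu \ (\mathrm{mod}\ 2)}} &q^{\frac{m^2+3(i^2+N_1^2+N_2^2+\dots + N_\nu^2)}{2}} {L-N_1\brack i}_{q^3}{3n_\nu\brack m}_{q}\\ &\times {2n_\nu + \frac{i-N_1-N_2-\dots-N_\nu-m}{2}\brack 2n_\nu}_{q^3} \prod_{j=1}^{\nu-1} {i- \sum_{k=1}^j N_k+n_j \brack n_j}_{q^3}\\ &= \sum_{j=-\infty} ^\infty q^{3\binom{\nu+2}{2}j^2+j} \left(\begin{array}{c} L,\, (\nu+2)j\\ (\nu+2)j \end{array}; q^3 \right)_2. \end{align*}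
   Context: For a variable $x$ and integer $n\ge 0$, $(x;x)_n=\prod_{k=1}^n(1-x^k)$, and $\frac{1}{(x;x)_n}=0$ for negative integers $n$. For integers $A,B$, ${A\brack B}_x=\frac{(x;x)_A}{(x;x)_B(x;x)_{A-B}}$ if $B\ge 0$ and $A-B\ge 0$, and $0$ otherwise. An empty product equals $1$. The Andrews–Baxter $q$-trinomial coefficient is \[ \left(\begin{array}{c}L,\, b\\ a \end{array};q\right)_2 = \sum_{n\geq 0 } q^{n(n+b)} \frac{(q;q)_L}{(q;q)_n(q;q)_{n+a}(q;q)_{L-2n-a}}, \] evaluated in the claim with $q$ replaced by $q^3$. *)

theory Defs
  imports
    "HOL-Library.FuncSet"
    "HOL-Number_Theory.Cong"
    "HOL-Computational_Algebra.Polynomial_Factorial"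
begin

text \<open>
  The base \<open>x\<close> is an element of an arbitrary field. All quotients below are meaningful once \<open>x\<close> is
  not a root of unity (\<open>x ^ n \<noteq> 1\<close> for every \<open>n > 0\<close>). This covers the formal variable, that is
  the indeterminate of a field of rational functions (lemma \<open>indeterminate_not_root_of_unity\<close>),
  as well as complex numbers with modulus less than one.
\<close>

definition qpoch :: "'a::field \<Rightarrow> nat \<Rightarrow> 'a" where
  "qpoch x n = (\<Prod>k = 1..n. 1 - x ^ k)"

text \<open>The reciprocal \<open>1 / (x; x)\<^sub>n\<close> for integers \<open>n\<close>, which is \<open>0\<close> by convention for \<open>n < 0\<close>.\<close>

definition inv_qpoch :: "'a::field \<Rightarrow> int \<Rightarrow> 'a" where
  "inv_qpoch x n = (if n < 0 then 0 else 1 / qpoch x (nat n))"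

definition qbinom :: "'a::field \<Rightarrow> int \<Rightarrow> int \<Rightarrow> 'a" where
  "qbinom x A B =
     (if B \<ge> 0 \<and> A - B \<ge> 0
      then qpoch x (nat A) / (qpoch x (nat B) * qpoch x (nat (A - B)))
      else 0)"

text \<open>
  The Andrews--Baxter trinomial coefficient with upper row \<open>L, b\<close>, lower row \<open>a\<close> and
  subscript \<open>2\<close>. Only finitely many terms are nonzero (lemma \<open>finite_qtrinom2_support\<close>); the library
  operator \<open>sum'\<close> sums the nonzero terms of a finitely supported family.
  The exponent \<open>n * (n + b)\<close> may be negative, hence the integer power.
\<close>

definition qtrinom2 :: "'a::field \<Rightarrow> nat \<Rightarrow> int \<Rightarrow> int \<Rightarrow> 'a" where
  "qtrinom2 x L b a =
     sum' (\<lambda>n::nat. x powi (int n * (int n + b)) *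
        (qpoch x L * inv_qpoch x (int n) * inv_qpoch x (int n + a)
          * inv_qpoch x (int L - 2 * int n - a))) UNIV"

text \<open>\<open>N\<^sub>k = n\<^sub>k + n\<^bsub>k+1\<^esub> + \<dots> + n\<^bsub>\<nu>\<^esub>\<close>\<close>

definition tail_sum :: "nat \<Rightarrow> (nat \<Rightarrow> nat) \<Rightarrow> nat \<Rightarrow> nat" where
  "tail_sum \<nu> n k = (\<Sum>j = k..\<nu>. n j)"

lemma finite_qtrinom2_support:
  "finite {n::nat. x powi (int n * (int n + b)) *
        (qpoch x L * inv_qpoch x (int n) * inv_qpoch x (int n + a)
          * inv_qpoch x (int L - 2 * int n - a)) \<noteq> (0::'a::field)}"
  by (rule finite_subset[of _ "{..L}"]) (auto simp: inv_qpoch_def split: if_splits)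

lemma finite_qtrinom2_index_support:
  fixes x :: "'a::field" and c :: int
  assumes "c > 0"
  shows "finite {j::int. qtrinom2 x L (c * j) (c * j) \<noteq> 0}"
proof (rule finite_subset)
  show "{j. qtrinom2 x L (c * j) (c * j) \<noteq> 0} \<subseteq> {- int L..int L}"
  proof
    fix j assume j: "j \<in> {j. qtrinom2 x L (c * j) (c * j) \<noteq> 0}"
    have "\<exists>n. inv_qpoch x (int n + c * j) \<noteq> 0 \<and> inv_qpoch x (int L - 2 * int n - c * j) \<noteq> 0"
    proof (rule ccontr)
      assume "\<not> ?thesis"
      then have "qtrinom2 x L (c * j) (c * j) = sum' (\<lambda>n::nat. 0) UNIV"
        unfolding qtrinom2_def by (intro sum.cong') auto
      with j show False by (simp add: sum.G_def)
    qed
    then obtain n where "int n + c * j \<ge> 0" "int L - 2 * int n - c * j \<ge> 0"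
      unfolding inv_qpoch_def by (metis not_less)
    then have "\<bar>c * j\<bar> \<le> int L" by linarith
    moreover have "\<bar>j\<bar> \<le> \<bar>c * j\<bar>"
      using assms mult_right_mono[of 1 c "\<bar>j\<bar>"] by (simp add: abs_mult)
    ultimately show "j \<in> {- int L..int L}" by auto
  qed
qed simp

text \<open>
  A tuple \<open>(n\<^sub>1, \<dots>, n\<^bsub>\<nu>\<^esub>)\<close> of non-negative integers is an extensional function on \<open>{1..\<nu>}\<close>. The
  following lemma shows that the multisum has finite support.
\<close>

lemma finite_multisum_support:
  fixes x y :: "'a::field"
  assumes "\<nu> > 0"
  shows "finite {(i::nat, m::nat, n). n \<in> {1..\<nu>} \<rightarrow>\<^sub>E UNIV \<and>
           qbinom x (int L - int (tail_sum \<nu> n 1)) (int i) \<noteq> 0 \<and>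
           qbinom y (3 * int (n \<nu>)) (int m) \<noteq> 0}"
proof (rule finite_subset)
  show "finite ({..L} \<times> {..3 * L} \<times> ({1..\<nu>} \<rightarrow>\<^sub>E {..L}))"
    by (intro finite_cartesian_product finite_PiE) auto
  have *: "(i, m, n) \<in> {..L} \<times> {..3 * L} \<times> ({1..\<nu>} \<rightarrow>\<^sub>E {..L})"
    if n: "n \<in> {1..\<nu>} \<rightarrow>\<^sub>E UNIV"
      and i: "qbinom x (int L - int (tail_sum \<nu> n 1)) (int i) \<noteq> 0"
      and m: "qbinom y (3 * int (n \<nu>)) (int m) \<noteq> 0"
    for i m n
  proof -
    from i have i': "tail_sum \<nu> n 1 + i \<le> L" by (auto simp: qbinom_def split: if_splits)
    from m have m': "m \<le> 3 * n \<nu>" by (auto simp: qbinom_def split: if_splits)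
    have le: "n k \<le> L" if "k \<in> {1..\<nu>}" for k
    proof -
      have "n k \<le> tail_sum \<nu> n 1"
        unfolding tail_sum_def by (rule member_le_sum) (use that in auto)
      with i' show ?thesis by simp
    qed
    have "m \<le> 3 * L" using m' le[of \<nu>] assms by simp
    moreover have "n \<in> {1..\<nu>} \<rightarrow>\<^sub>E {..L}"
      using n le unfolding PiE_iff by blast
    ultimately show ?thesis
      using i' by simp
  qed
  show "{(i::nat, m::nat, n). n \<in> {1..\<nu>} \<rightarrow>\<^sub>E UNIV \<and>
           qbinom x (int L - int (tail_sum \<nu> n 1)) (int i) \<noteq> 0 \<and>
           qbinom y (3 * int (n \<nu>)) (int m) \<noteq> 0} \<subseteq> {..L} \<times> {..3 * L} \<times> ({1..\<nu>} \<rightarrow>\<^sub>E {..L})"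
    using * by blast
qed

lemma indeterminate_not_root_of_unity:
  assumes "n > 0"
  shows "to_fract (monom (1::'a::field) 1) ^ n \<noteq> 1"
proof
  have pow: "to_fract p ^ k = to_fract (p ^ k)" for p :: "'a poly" and k
    by (induction k) simp_all
  assume "to_fract (monom (1::'a) 1) ^ n = 1"
  then have "to_fract (monom (1::'a) n) = to_fract 1"
    by (simp add: pow monom_power)
  then have "monom (1::'a) n = 1" by (simp only: to_fract_eq_iff)
  with assms show False by (metis degree_1 degree_monom_eq neq0_conv one_neq_zero)
qed

end

theory Submission
  imports Defs
begin

text \<open>
  Put \<open>p = q\<^sup>3\<close> and let \<open>T(L, M, a, b)\<close> be Warnaar's refined q-trinomial coefficients with base \<open>p\<close>. The
  q-binomial theorem, split modulo 3, and the q-Pfaff--Saalschuetz sum show that the sum over \<open>m\<close> on the left-hand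
  side, as a function of \<open>L = i - N\<^sub>1 - \<dots> - N\<^sub>\<nu>\<close> and \<open>M = n\<^sub>\<nu>\<close>, is \<open>\<Sum>\<^sub>j q\<^bsup>3 j\<^sup>2/2 + j\<^esup> T(L, M, j, j)\<close>. Each of the sums
  over \<open>N\<^sub>\<nu>, \<dots>, N\<^sub>1\<close> is an instance of the transformation
  \<open>\<Sum>\<^sub>i p\<^bsup>i\<^sup>2/2\<^esup> [L + M - i, L] T(L - i, i, a, b) = p\<^bsup>b\<^sup>2/2\<^esup> T(L, M, a + b, b)\<close>, hence raises \<open>a = k j\<close> to
  \<open>(k + 1) j\<close>; for the outermost one \<open>M = L - i\<close>. The remaining sum over \<open>i\<close> is
  \<open>\<Sum>\<^sub>i p\<^bsup>i\<^sup>2/2\<^esup> T(i, L - i, a, b)\<close>, which is \<open>p\<^bsup>a\<^sup>2/2\<^esup>\<close> times the Andrews--Baxter coefficient with index \<open>a + b\<close>. Both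
  transformations are proved by induction on \<open>b\<close> from contiguous relations for \<open>T\<close>; for \<open>b = 0\<close> they reduce to the
  q-Pfaff--Saalschuetz and the q-Vandermonde sum.
\<close>

text \<open>The exponents 3 i^2/2, 3 N_k^2/2 and m^2/2 of the multisum are only jointly integral, by
  the parity condition, and a general field contains no square root of \<open>q\<close>. Rescaling
  the trinomials by p^((L - a)/2) turns every quadratic weight into a triangular number. The linear
  terms so introduced cancel in the end precisely when i = N_1 + ... + N_\<nu> + m + 2 t, where t is
  the excess of the upper over the lower index in the last Gaussian coefficient; solvability of this
  equation is the parity condition.

  The second obstacle is the boundary. All contiguous relations rest on Pascal's rule, which fails
  for the coefficient [0, 0], so they are stated for positive indices only, and the inductions stay
  in 0 \<le> b \<le> a. The iteration meets only the pairs (k j, j) with k \<ge> 1, which lie in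
  that range for j \<ge> 0; negative j are reached through the symmetry T(L, M, -a, -b) = T(L, M, a,
  b).\<close>

lemma sum_int_shift:
  fixes f :: "int \<Rightarrow> 'a::comm_monoid_add"
  assumes "f (lo - 1) = 0" "f hi = 0"
  shows "(\<Sum>k\<in>{lo..hi}. f (k - 1)) = (\<Sum>k\<in>{lo..hi}. f k)"
  by (rule sum.reindex_bij_witness_not_neutral[where S' = "{lo}" and T' = "{hi}" and i = "\<lambda>k. k + 1" and j = "\<lambda>k. k - 1"])
    (use assms in auto)

lemma sum_int_telescope:
  fixes G :: "int \<Rightarrow> 'a::ab_group_add"
  assumes "G lo = 0" "G (hi + 1) = 0"
  shows "(\<Sum>k\<in>{lo..hi}. G k - G (k + 1)) = 0"
proof -
  have "(\<Sum>k\<in>{lo..hi}. G ((k - 1) + 1)) = (\<Sum>k\<in>{lo..hi}. G (k + 1))"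
    by (rule sum_int_shift[of "\<lambda>k. G (k + 1)"]) (use assms in auto)
  then show ?thesis by (simp add: sum_subtractf)
qed

definition tri :: "int \<Rightarrow> int" where
  "tri n = n * (n + 1) div 2"

lemma two_tri: "2 * tri n = n * (n + 1)"
  unfolding tri_def by simp

lemma tri_rec: "tri n = tri (n - 1) + n"
  using two_tri[of n] two_tri[of "n - 1"] by (simp add: algebra_simps)

text \<open>In this form the Gaussian binomial coefficient is symmetric and vanishes as soon as one of
  its arguments is negative.\<close>

definition qbin :: "'a::field \<Rightarrow> int \<Rightarrow> int \<Rightarrow> 'a" where
  "qbin x k l = qbinom x (k + l) l"

lemma qbinom_eq_qbin: "qbinom x A B = qbin x (A - B) B"
  by (simp add: qbin_def)

lemma qbin_neg [simp]: "k < 0 \<Longrightarrow> qbin x k l = 0" "l < 0 \<Longrightarrow> qbin x k l = 0"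
  by (auto simp: qbin_def qbinom_def)

lemma qbin_of_nat: "qbin x (int k) (int l) = qpoch x (k + l) / (qpoch x k * qpoch x l)"
proof -
  have "nat (int k + int l) = k + l" by simp
  then show ?thesis by (simp add: qbin_def qbinom_def mult.commute)
qed

lemma qpoch_0 [simp]: "qpoch x 0 = 1"
  by (simp add: qpoch_def)

lemma qpoch_Suc: "qpoch x (Suc n) = qpoch x n * (1 - x ^ Suc n)"
  by (simp add: qpoch_def)

lemma qbin_commute: "qbin x k l = qbin x l k"
proof (cases "k < 0 \<or> l < 0")
  case False
  then obtain a b where "k = int a" "l = int b" by (metis nonneg_int_cases not_less)
  then show ?thesis by (simp add: qbin_of_nat add.commute mult.commute)
qed auto

section \<open>Gaussian coefficients over a base that is not a root of unity\<close>

locale nonroot =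
  fixes p :: "'a::field"
  assumes p0: "p \<noteq> 0" and nonroot: "\<And>n::nat. n > 0 \<Longrightarrow> p ^ n \<noteq> 1"
begin

lemma qpoch_nonzero [simp]: "qpoch p n \<noteq> 0"
  using nonroot by (auto simp: qpoch_def)

lemma qbin_0_left: "l \<ge> 0 \<Longrightarrow> qbin p 0 l = 1"
  using qbin_of_nat[of p 0 "nat l"] by simp

lemma qbin_0_right: "k \<ge> 0 \<Longrightarrow> qbin p k 0 = 1"
  using qbin_0_left qbin_commute by metis

lemma pw_add: "p powi (m + n) = p powi m * p powi n"
  by (simp add: power_int_add p0)

text \<open>The zero convention makes this valid for every integer: at \<open>n = 0\<close> the
  factor \<open>1 - p powi n\<close> vanishes, matching the right-hand side. Hence the telescoping
  in \<open>tsum_raise\<close> needs no boundary cases.\<close>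

lemma inv_qpoch_rec: "inv_qpoch p n * (1 - p powi n) = inv_qpoch p (n - 1)"
proof -
  consider "n < 0" | "n = 0" | m where "n = int (Suc m)"
    by (metis int_cases2 linorder_neqE not0_implies_Suc of_nat_0 of_nat_0_le_iff nonneg_int_cases not_less)
  then show ?thesis
  proof cases
    case (3 m)
    have "nat (int (Suc m)) = Suc m" by simp
    moreover have "1 - p ^ Suc m \<noteq> 0" using nonroot[of "Suc m"] by auto
    moreover have "p powi (int (Suc m)) = p ^ Suc m" by (rule power_int_of_nat)
    ultimately show ?thesis
      unfolding 3 inv_qpoch_def by (simp add: qpoch_Suc del: power_Suc of_nat_Suc) (simp add: field_simps)
  qed (auto simp: inv_qpoch_def)
qed

text \<open>The excluded point is a genuine exception: there the left-hand side is 1 and the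
  right-hand side 0. Most side conditions and case distinctions on indices below serve to avoid
  it.\<close>

lemma qbin_pascal:
  assumes "k \<noteq> 0 \<or> l \<noteq> 0"
  shows "qbin p k l = qbin p (k - 1) l + p powi k * qbin p k (l - 1)"
proof -
  consider "k < 0 \<or> l < 0" | "k = 0" "l > 0" | "k > 0" "l = 0" | a b where "k = int (Suc a)" "l = int (Suc b)"
    using assms by (metis gr0_implies_Suc linorder_neqE zero_less_imp_eq_int)
  then show ?thesis
  proof cases
    case (4 a b)
    have nz: "1 - p ^ Suc a \<noteq> 0" "1 - p ^ Suc b \<noteq> 0"
      using nonroot[of "Suc a"] nonroot[of "Suc b"] by auto
    have e: "int (Suc a) - 1 = int a" "int (Suc b) - 1 = int b" by auto
    have pw: "p powi (int (Suc a)) = p ^ Suc a" by (rule power_int_of_nat)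
    have "p ^ Suc (Suc (a + b)) = p ^ Suc a * p ^ Suc b" by (simp add: power_add)
    then have "qpoch p (Suc a + Suc b) = qpoch p (Suc (a + b)) * (1 - p ^ Suc a * p ^ Suc b)"
      by (simp add: qpoch_Suc)
    moreover have "qpoch p (a + Suc b) = qpoch p (Suc (a + b))" "qpoch p (Suc a + b) = qpoch p (Suc (a + b))"
      by simp_all
    ultimately show ?thesis
      unfolding 4 e qbin_of_nat pw qpoch_Suc[of p a] qpoch_Suc[of p b] using nz
      by (simp add: divide_simps del: power_Suc) (simp add: algebra_simps del: power_Suc)
  qed (auto simp: qbin_0_left qbin_0_right)
qed

lemma qbin_pascal':
  assumes "k \<noteq> 0 \<or> l \<noteq> 0"
  shows "qbin p k l = qbin p k (l - 1) + p powi l * qbin p (k - 1) l"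
  using qbin_pascal[of l k] assms by (metis qbin_commute)

section \<open>Summation formulas\<close>

lemma saalschuetz_base:
  assumes "R \<ge> u"
  shows "(\<Sum>r = 0..R. p powi ((u - r) * (v - r)) * qbin p (u - r) (r - u) * qbin p (v - r) (int n - v + r) * qbin p (int n) r)
    = qbin p u (v - u) * qbin p v (int n + u - v)"
proof -
  have "(\<Sum>r = 0..R. p powi ((u - r) * (v - r)) * qbin p (u - r) (r - u) * qbin p (v - r) (int n - v + r) * qbin p (int n) r)
     = (\<Sum>r = 0..R. if r = u then qbin p (v - u) (int n - v + u) * qbin p (int n) u else 0)"
  proof (intro sum.cong refl)
    fix r :: int
    show "p powi ((u - r) * (v - r)) * qbin p (u - r) (r - u) * qbin p (v - r) (int n - v + r) * qbin p (int n) r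
      = (if r = u then qbin p (v - u) (int n - v + u) * qbin p (int n) u else 0)"
    proof (cases "r = u")
      case False
      then have "u - r < 0 \<or> r - u < 0" by linarith
      then have "qbin p (u - r) (r - u) = 0" by auto
      then show ?thesis using False by simp
    qed (simp add: qbin_0_left)
  qed
  also have "\<dots> = (if u \<ge> 0 then qbin p (v - u) (int n - v + u) * qbin p (int n) u else 0)"
    using assms by simp
  also have "\<dots> = qbin p u (v - u) * qbin p v (int n + u - v)"
  proof (cases "u \<ge> 0 \<and> v - u \<ge> 0 \<and> int n + u - v \<ge> 0")
    case True
    then obtain a b c where abc: "u = int a" "v - u = int b" "int n + u - v = int c"
      by (metis nonneg_int_cases)
    then have e: "v = int (a + b)" "int n = int (b + c)" "int n - v + u = int c" by auto
    have "qbin p (v - u) (int n - v + u) * qbin p (int n) u = qbin p (int b) (int c) * qbin p (int (b + c)) (int a)"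
      using abc e by simp
    \<comment> \<open>Both products equal the q-multinomial coefficient with parts \<open>a\<close>,
      \<open>b\<close>, \<open>c\<close>.\<close>
    also have "\<dots> = qbin p (int a) (int b) * qbin p (int (a + b)) (int c)"
      unfolding qbin_of_nat by (simp add: ac_simps)
    finally show ?thesis using True abc e by simp
  qed auto
  finally show ?thesis .
qed

text \<open>The q-Pfaff--Saalschuetz summation. Both sides satisfy the recurrence that follows from adding one factor
  to the numerator of the generating function
  \<open>(-x p\<^bsup>1/2\<^esup>; p)\<^sub>m (-y p\<^bsup>1/2\<^esup>; p)\<^sub>n / (x y; p)\<^bsub>m+n+1\<^esub>\<close>.\<close>

lemma saalschuetz:
  assumes "R \<ge> u"
  shows "(\<Sum>r = 0..R. p powi ((u - r) * (v - r)) * qbin p (u - r) (int m - u + r)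
            * qbin p (v - r) (int n - v + r) * qbin p (int m + int n) r)
    = qbin p u (int m + v - u) * qbin p v (int n + u - v)"
  using assms
proof (induction m arbitrary: u v R)
  case 0
  then show ?case using saalschuetz_base[of u R v n] by simp
next
  case (Suc m)
  note IH = Suc.IH
  define t where "t m u v r = p powi ((u - r) * (v - r)) * qbin p (u - r) (int m - u + r)
            * qbin p (v - r) (int n - v + r) * qbin p (int m + int n) r" for m u v r
  \<comment> \<open>The recurrence also refers to \<open>(u - 1, v - 1)\<close> at the same
    \<open>Suc m\<close>. A second induction on a bound for \<open>u\<close> handles this; for
    \<open>u < 0\<close> everything vanishes.\<close>
  have "(\<Sum>r = 0..R. t (Suc m) u v r) = qbin p u (int (Suc m) + v - u) * qbin p v (int n + u - v)"
    if "u < int U" "R \<ge> u" for U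
    using that
  proof (induction U arbitrary: u v)
    case 0
    then have "t (Suc m) u v r = 0" if "r \<in> {0..R}" for r
      using that unfolding t_def by simp
    then show ?case using 0 by simp
  next
    case (Suc U)
    \<comment> \<open>With F_m the generating function, this is (1 - x y p^(m+n+1)) F_(m+1) = (1 + x
      p^(m+1/2)) F_m, applied to the single terms of the coefficient of x^u y^v. Division by
      p^((u-v)^2/2) removes the half powers.\<close>
    have split: "t (Suc m) u v r - p powi (int m + int n + 1) * t (Suc m) (u - 1) (v - 1) (r - 1)
        = t m u v r + p powi (int m + 1 + v - u) * t m (u - 1) v r" if "r \<ge> 0" for r
    proof -
      have 1: "qbin p (int (Suc m) + int n) r - p powi (int m + int n + 1) * qbin p (int (Suc m) + int n) (r - 1)
          = qbin p (int m + int n) r"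
        using qbin_pascal[of "int (Suc m) + int n" r] by (simp add: algebra_simps)
      have 2: "qbin p (u - r) (int (Suc m) - u + r) =
          qbin p (u - r) (int m - u + r) + p powi (int m + 1 - u + r) * qbin p (u - 1 - r) (int m - (u - 1) + r)"
        using qbin_pascal'[of "u - r" "int (Suc m) - u + r"] by (simp add: algebra_simps)
      have 3: "p powi ((u - r) * (v - r)) * p powi (int m + 1 - u + r)
          = p powi (int m + 1 + v - u) * p powi ((u - 1 - r) * (v - r))"
        unfolding pw_add[symmetric] by (rule arg_cong[of _ _ "\<lambda>e. p powi e"]) (simp add: algebra_simps)
      define X where "X = p powi ((u - r) * (v - r)) * qbin p (v - r) (int n - v + r)"
      have "t (Suc m) u v r - p powi (int m + int n + 1) * t (Suc m) (u - 1) (v - 1) (r - 1)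
        = X * qbin p (u - r) (int (Suc m) - u + r) * (qbin p (int (Suc m) + int n) r - p powi (int m + int n + 1) * qbin p (int (Suc m) + int n) (r - 1))"
        unfolding t_def X_def by (simp add: algebra_simps)
      also have "\<dots> = X * (qbin p (u - r) (int m - u + r) + p powi (int m + 1 - u + r) * qbin p (u - 1 - r) (int m - (u - 1) + r)) * qbin p (int m + int n) r"
        unfolding 1 2 ..
      also have "\<dots> = t m u v r + (p powi ((u - r) * (v - r)) * p powi (int m + 1 - u + r)) * qbin p (v - r) (int n - v + r)
          * qbin p (u - 1 - r) (int m - (u - 1) + r) * qbin p (int m + int n) r"
        unfolding t_def X_def by (simp add: algebra_simps)
      also have "\<dots> = t m u v r + p powi (int m + 1 + v - u) * t m (u - 1) v r"
        unfolding 3 t_def by (simp add: algebra_simps)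
      finally show ?thesis .
    qed
    have shift: "(\<Sum>r = 0..R. t (Suc m) (u - 1) (v - 1) (r - 1)) = (\<Sum>r = 0..R. t (Suc m) (u - 1) (v - 1) r)"
      by (rule sum_int_shift) (use Suc.prems in \<open>auto simp: t_def\<close>)
    have "(\<Sum>r = 0..R. t (Suc m) u v r) - p powi (int m + int n + 1) * (\<Sum>r = 0..R. t (Suc m) (u - 1) (v - 1) r)
       = (\<Sum>r = 0..R. t (Suc m) u v r - p powi (int m + int n + 1) * t (Suc m) (u - 1) (v - 1) (r - 1))"
      unfolding shift[symmetric] by (simp add: sum_subtractf sum_distrib_left)
    also have "\<dots> = (\<Sum>r = 0..R. t m u v r + p powi (int m + 1 + v - u) * t m (u - 1) v r)"
      by (intro sum.cong refl split) simp
    also have "\<dots> = (\<Sum>r = 0..R. t m u v r) + p powi (int m + 1 + v - u) * (\<Sum>r = 0..R. t m (u - 1) v r)"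
      by (simp add: sum.distrib sum_distrib_left)
    also have "(\<Sum>r = 0..R. t m u v r) = qbin p u (int m + v - u) * qbin p v (int n + u - v)"
      unfolding t_def using Suc.prems by (intro IH)
    also have "(\<Sum>r = 0..R. t m (u - 1) v r) = qbin p (u - 1) (int m + v - (u - 1)) * qbin p v (int n + (u - 1) - v)"
      unfolding t_def using Suc.prems by (intro IH) simp
    also have "(\<Sum>r = 0..R. t (Suc m) (u - 1) (v - 1) r)
       = qbin p (u - 1) (int (Suc m) + (v - 1) - (u - 1)) * qbin p (v - 1) (int n + (u - 1) - (v - 1))"
      using Suc.prems by (intro Suc.IH) auto
    finally have eq: "(\<Sum>r = 0..R. t (Suc m) u v r) = p powi (int m + int n + 1) * (qbin p (u - 1) (int (Suc m) + (v - 1) - (u - 1)) * qbin p (v - 1) (int n + (u - 1) - (v - 1)))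
       + (qbin p u (int m + v - u) * qbin p v (int n + u - v)
       + p powi (int m + 1 + v - u) * (qbin p (u - 1) (int m + v - (u - 1)) * qbin p v (int n + (u - 1) - v)))"
      by (simp add: algebra_simps)
    define g where "g = qbin p (u - 1) (int m + 1 + v - u)"
    \<comment> \<open>The exceptional point of Pascal's rule would require \<open>v < 0\<close> here
      and \<open>u < 1\<close> in \<open>a2\<close>; in both cases the accompanying factor is
      zero.\<close>
    have a1: "qbin p u (int (Suc m) + v - u) * qbin p v (int n + u - v)
      = (qbin p u (int m + v - u) + p powi (int m + 1 + v - u) * g) * qbin p v (int n + u - v)"
    proof (cases "v < 0")
      case False
      then show ?thesis unfolding g_def
        using qbin_pascal'[of u "int m + 1 + v - u"] by (simp add: algebra_simps)
    qed simp
    have a2: "g * qbin p v (int n + u - v) = g * (qbin p v (int n + u - v - 1) + p powi (int n + u - v) * qbin p (v - 1) (int n + u - v))"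
    proof (cases "u < 1")
      case False
      then show ?thesis 
        using qbin_pascal'[of v "int n + u - v"] by (simp add: algebra_simps)
    qed (simp add: g_def)
    have a3: "p powi (int m + 1 + v - u) * p powi (int n + u - v) = p powi (int m + int n + 1)"
      unfolding pw_add[symmetric] by (simp add: algebra_simps)
    have "qbin p u (int (Suc m) + v - u) * qbin p v (int n + u - v) = qbin p u (int m + v - u) * qbin p v (int n + u - v)
       + p powi (int m + 1 + v - u) * (g * qbin p v (int n + u - v))"
      unfolding a1 by (simp add: algebra_simps)
    also have "\<dots> = qbin p u (int m + v - u) * qbin p v (int n + u - v)
       + p powi (int m + 1 + v - u) * g * qbin p v (int n + u - v - 1)
       + (p powi (int m + 1 + v - u) * p powi (int n + u - v)) * g * qbin p (v - 1) (int n + u - v)"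
      unfolding a2 by (simp add: algebra_simps)
    finally show ?case unfolding eq a3 g_def by (simp add: algebra_simps)
  qed
  from this[of "nat (u + 1)"] Suc.prems show ?case unfolding t_def by simp
qed

text \<open>Pascal's rule on the first coefficient splits the sum into the cases
  \<open>(a, c)\<close> and \<open>(a + 1, c - 1)\<close> for \<open>k\<close>. On the right the
  same rule recombines them, and \<open>a \<ge> 0\<close> keeps it away from its exceptional
  point.\<close>

lemma q_vandermonde:
  assumes "a \<ge> 0" "R \<ge> c"
  shows "(\<Sum>u = 0..R. p powi (u * (u + a)) * qbin p u (int k - u) * qbin p (c - u) (a + u))
    = qbin p c (int k + a)"
  using assms
proof (induction k arbitrary: a c)
  case 0
  have "(\<Sum>u = 0..R. p powi (u * (u + a)) * qbin p u (int 0 - u) * qbin p (c - u) (a + u))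
    = (\<Sum>u = 0..R. if u = 0 then qbin p c a else 0)"
    by (intro sum.cong refl) (auto simp: qbin_0_left)
  also have "\<dots> = qbin p c a" using 0 by (cases "R \<ge> 0") auto
  finally show ?case by simp
next
  case (Suc k)
  define t where "t k a c u = p powi (u * (u + a)) * qbin p u (int k - u) * qbin p (c - u) (a + u)" for k a c u
  have split: "t (Suc k) a c u = t k a c u
      + p powi (a + 1 + int k) * t k (a + 1) (c - 1) (u - 1)" for u
  proof -
    have 1: "qbin p u (int (Suc k) - u) = qbin p u (int k - u) + p powi (int k + 1 - u) * qbin p (u - 1) (int k - (u - 1))"
      using qbin_pascal'[of u "int (Suc k) - u"] by (simp add: algebra_simps)
    have 2: "p powi (u * (u + a)) * p powi (int k + 1 - u) = p powi (a + 1 + int k) * p powi ((u - 1) * (u - 1 + (a + 1)))"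
      unfolding pw_add[symmetric] by (rule arg_cong[of _ _ "\<lambda>e. p powi e"]) (simp add: algebra_simps)
    have "t (Suc k) a c u = p powi (u * (u + a)) * qbin p u (int k - u) * qbin p (c - u) (a + u)
      + (p powi (u * (u + a)) * p powi (int k + 1 - u)) * qbin p (u - 1) (int k - (u - 1)) * qbin p (c - u) (a + u)"
      unfolding t_def 1 by (simp add: algebra_simps)
    then show ?thesis unfolding 2 by (simp add: t_def mult.assoc)
  qed
  have shift: "(\<Sum>u = 0..R. t k (a + 1) (c - 1) (u - 1)) = (\<Sum>u = 0..R. t k (a + 1) (c - 1) u)"
    by (rule sum_int_shift) (use Suc.prems in \<open>auto simp: t_def\<close>)
  have "(\<Sum>u = 0..R. t (Suc k) a c u) = (\<Sum>u = 0..R. t k a c u) + p powi (a + 1 + int k) * (\<Sum>u = 0..R. t k (a + 1) (c - 1) u)"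
    unfolding shift[symmetric] by (simp add: split sum.distrib sum_distrib_left)
  also have "(\<Sum>u = 0..R. t k a c u) = qbin p c (int k + a)"
    unfolding t_def using Suc.prems by (intro Suc.IH)
  also have "(\<Sum>u = 0..R. t k (a + 1) (c - 1) u) = qbin p (c - 1) (int k + (a + 1))"
    unfolding t_def using Suc.prems by (intro Suc.IH) auto
  also have "qbin p c (int k + a) + p powi (a + 1 + int k) * qbin p (c - 1) (int k + (a + 1)) = qbin p c (int (Suc k) + a)"
    using qbin_pascal'[of c "int (Suc k) + a"] Suc.prems by (simp add: algebra_simps)
  finally show ?case unfolding t_def .
qed

end

section \<open>Refined q-trinomial coefficients\<close>

text \<open>Warnaar's refined q-trinomial coefficient \<open>T(L, M, a, b)\<close> is the sum of
  \<open>x\<^bsup>n\<^sup>2/2\<^esup> [M, n] [M + b + u, u] [M - b + v, v]\<close> over \<open>n + u + v = L\<close>, \<open>v - u = a\<close>. It is multiplied here by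
  \<open>x\<^bsup>(L - a)/2\<^esup>\<close>, which turns the half-integral exponents into integral ones.\<close>

definition rtri_term :: "'a::field \<Rightarrow> int \<Rightarrow> int \<Rightarrow> int \<Rightarrow> int \<Rightarrow> int \<Rightarrow> 'a" where
  "rtri_term x L M a b u = x powi (tri (L - a - 2 * u) + u) * qbin x (L - a - 2 * u) (M - (L - a - 2 * u))
     * qbin x (M + b) u * qbin x (M - b) (u + a)"

definition rtri :: "'a::field \<Rightarrow> int \<Rightarrow> int \<Rightarrow> int \<Rightarrow> int \<Rightarrow> 'a" where
  "rtri x L M a b = (\<Sum>u = 0..\<bar>L\<bar> + \<bar>a\<bar>. rtri_term x L M a b u)"

lemma rtri_term_eq_0:
  "u < 0 \<Longrightarrow> rtri_term x L M a b u = 0" "2 * u > L - a \<Longrightarrow> rtri_term x L M a b u = 0"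
  "M < 0 \<Longrightarrow> rtri_term x L M a b u = 0" "u + a < 0 \<Longrightarrow> rtri_term x L M a b u = 0"
proof -
  assume "M < 0"
  then have "L - a - 2 * u < 0 \<or> M - (L - a - 2 * u) < 0" by linarith
  then show "rtri_term x L M a b u = 0" by (auto simp: rtri_term_def)
qed (auto simp: rtri_term_def)

text \<open>Any sufficiently large bound gives the same sum, so all trinomials in a contiguous
  relation can be summed over one common range and the relation proved term by term.\<close>

lemma rtri_eq_sum:
  assumes "L - a \<le> K"
  shows "rtri x L M a b = (\<Sum>u = 0..K. rtri_term x L M a b u)"
proof -
  have 0: "rtri_term x L M a b u = 0" if "u > K" for u
    using that assms by (cases "u < 0") (auto intro: rtri_term_eq_0)
  have 1: "rtri_term x L M a b u = 0" if "u > \<bar>L\<bar> + \<bar>a\<bar>" for u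
    using that by (auto intro: rtri_term_eq_0)
  show ?thesis unfolding rtri_def
  by (rule sum.reindex_bij_witness_not_neutral[where i = id and j = id
        and S' = "{K + 1..\<bar>L\<bar> + \<bar>a\<bar>}" and T' = "{\<bar>L\<bar> + \<bar>a\<bar> + 1..K}"])
    (auto simp: 0 1)
qed

lemma rtri_eq_0: "L < 0 \<Longrightarrow> rtri x L M a b = 0" "L < a \<Longrightarrow> rtri x L M a b = 0" "M < 0 \<Longrightarrow> rtri x L M a b = 0"
proof -
  assume "L < 0"
  have "u < 0 \<or> 2 * u > L - a \<or> u + a < 0" for u using \<open>L < 0\<close> by linarith
  then show "rtri x L M a b = 0"
    unfolding rtri_def by (intro sum.neutral) (metis rtri_term_eq_0)
next
  assume "L < a"
  then show "rtri x L M a b = 0"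
    unfolding rtri_def by (intro sum.neutral) (auto intro: rtri_term_eq_0)
next
  assume "M < 0"
  then show "rtri x L M a b = 0"
    unfolding rtri_def by (intro sum.neutral) (auto intro: rtri_term_eq_0)
qed

section \<open>Contiguous relations for the refined trinomials\<close>

context nonroot begin

text \<open>Pascal's rule on the last factor. Applied with \<open>b - 1\<close>, it produces a term
  with tops \<open>M + b - 1\<close> and \<open>M - b\<close>, the same one that
  \<open>rtri_term_raise_left\<close> produces from \<open>b\<close>; equating the two gives
  \<open>rtri_raise\<close>.\<close>

lemma rtri_term_raise_right:
  assumes "a + u \<noteq> 0"
  shows "rtri_term p L M a b u - p powi (M - b) * rtri_term p (L - 1) M (a - 1) b u
   = p powi (tri (L - a - 2 * u) + u) * qbin p (L - a - 2 * u) (M - (L - a - 2 * u))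
      * qbin p (M + b) u * qbin p (M - b - 1) (u + a)"
proof -
  have 1: "L - 1 - (a - 1) - 2 * u = L - a - 2 * u" "u + (a - 1) = u + a - 1" by auto
  have 2: "qbin p (M - b - 1) (u + a) = qbin p (M - b) (u + a) - p powi (M - b) * qbin p (M - b) (u + a - 1)"
    using qbin_pascal[of "M - b" "u + a"] assms by (simp add: algebra_simps)
  show ?thesis unfolding rtri_term_def 1 2 by (simp add: algebra_simps)
qed

text \<open>The hypothesis excludes the failure of Pascal's rule at \<open>M + b = 0\<close>, except
  when \<open>M < 0\<close>, where all terms vanish anyway. It holds automatically for
  \<open>b \<ge> 1\<close>.\<close>

lemma rtri_term_raise_left:
  assumes "M + b \<noteq> 0 \<or> M < 0"
  shows "rtri_term p L M a b u - p powi (M + b + 1) * rtri_term p (L - 1) M (a + 1) b (u - 1)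
   = p powi (tri (L - a - 2 * u) + u) * qbin p (L - a - 2 * u) (M - (L - a - 2 * u))
      * qbin p (M + b - 1) u * qbin p (M - b) (u + a)"
proof (cases "M < 0")
  case True
  then have "L - a - 2 * u < 0 \<or> M - (L - a - 2 * u) < 0" by linarith
  then show ?thesis using True by (auto simp: rtri_term_eq_0)
next
  case False
  have 1: "L - 1 - (a + 1) - 2 * (u - 1) = L - a - 2 * u" "u - 1 + (a + 1) = u + a" by auto
  have 2: "qbin p (M + b - 1) u = qbin p (M + b) u - p powi (M + b) * qbin p (M + b) (u - 1)"
    using qbin_pascal[of "M + b" u] assms False by (simp add: algebra_simps)
  have 3: "p powi (M + b + 1) * p powi (tri (L - a - 2 * u) + (u - 1))
      = p powi (tri (L - a - 2 * u) + u) * p powi (M + b)"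
    unfolding pw_add[symmetric] by (rule arg_cong[of _ _ "\<lambda>e. p powi e"]) simp
  have 4: "p powi (M + b + 1) * rtri_term p (L - 1) M (a + 1) b (u - 1)
     = p powi (tri (L - a - 2 * u) + u) * p powi (M + b) * qbin p (L - a - 2 * u) (M - (L - a - 2 * u))
      * qbin p (M + b) (u - 1) * qbin p (M - b) (u + a)"
    unfolding rtri_term_def 1 mult.assoc[symmetric] 3 ..
  show ?thesis unfolding 4 unfolding rtri_term_def 2 by (simp add: algebra_simps)
qed

lemma rtri_raise:
  assumes "a \<ge> 1" "b \<ge> 1"
  shows "rtri p L M a (b - 1) - p powi (M - b + 1) * rtri p (L - 1) M (a - 1) (b - 1)
   = rtri p L M a b - p powi (M + b + 1) * rtri p (L - 1) M (a + 1) b"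
proof -
  define K where "K = \<bar>L\<bar> + \<bar>a\<bar>"
  have "rtri p L M a (b - 1) - p powi (M - b + 1) * rtri p (L - 1) M (a - 1) (b - 1)
    = (\<Sum>u = 0..K. rtri_term p L M a (b - 1) u - p powi (M - (b - 1)) * rtri_term p (L - 1) M (a - 1) (b - 1) u)"
    by (simp add: rtri_eq_sum[of _ _ K] K_def sum_subtractf sum_distrib_left algebra_simps)
  also have "\<dots> = (\<Sum>u = 0..K. rtri_term p L M a b u - p powi (M + b + 1) * rtri_term p (L - 1) M (a + 1) b (u - 1))"
    proof (intro sum.cong refl)
    fix u assume "u \<in> {0..K}"
    then have "rtri_term p L M a (b - 1) u - p powi (M - (b - 1)) * rtri_term p (L - 1) M (a - 1) (b - 1) u
      = p powi (tri (L - a - 2 * u) + u) * qbin p (L - a - 2 * u) (M - (L - a - 2 * u))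
        * qbin p (M + (b - 1)) u * qbin p (M - (b - 1) - 1) (u + a)"
      using assms by (intro rtri_term_raise_right) auto
    also have "\<dots> = p powi (tri (L - a - 2 * u) + u) * qbin p (L - a - 2 * u) (M - (L - a - 2 * u))
        * qbin p (M + b - 1) u * qbin p (M - b) (u + a)"
      by (simp add: algebra_simps)
    also have "\<dots> = rtri_term p L M a b u - p powi (M + b + 1) * rtri_term p (L - 1) M (a + 1) b (u - 1)"
      using assms by (intro rtri_term_raise_left[symmetric]) auto
    finally show "rtri_term p L M a (b - 1) u - p powi (M - (b - 1)) * rtri_term p (L - 1) M (a - 1) (b - 1) u
      = rtri_term p L M a b u - p powi (M + b + 1) * rtri_term p (L - 1) M (a + 1) b (u - 1)" .
  qed
  also have "\<dots> = rtri p L M a b - p powi (M + b + 1) * (\<Sum>u = 0..K. rtri_term p (L - 1) M (a + 1) b (u - 1))"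
    by (simp add: rtri_eq_sum[of _ _ K] K_def sum_subtractf sum_distrib_left)
  also have "(\<Sum>u = 0..K. rtri_term p (L - 1) M (a + 1) b (u - 1)) = (\<Sum>u = 0..K. rtri_term p (L - 1) M (a + 1) b u)"
    by (rule sum_int_shift) (auto simp: K_def intro: rtri_term_eq_0)
  also have "\<dots> = rtri p (L - 1) M (a + 1) b"
    by (simp add: rtri_eq_sum[of _ _ K] K_def)
  finally show ?thesis .
qed

text \<open>This is the recurrence that the right-hand side of the Burge transformation must
  satisfy, with \<open>s = a + b\<close>. Differencing in \<open>M\<close> splits each side into two
  families, \<open>X1\<close>, \<open>X2\<close> and \<open>Y1\<close>, \<open>Y2\<close>, which
  match crosswise: \<open>X2\<close> with \<open>Y1\<close> term by term, and \<open>X1\<close> with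
  \<open>Y2\<close> only after a shift of \<open>u\<close>.\<close>

lemma rtri_raise_diff:
  assumes "s \<ge> 2" "b \<ge> 1"
  shows "p powi b * (rtri p L M s b - rtri p L (M - 1) s b - p powi (M + b + 1) * rtri p (L - 1) M (s + 1) b)
   = rtri p L M (s - 1) (b - 1) - rtri p L (M - 1) (s - 1) (b - 1)
     - p powi (M - b + 1) * rtri p (L - 1) M (s - 2) (b - 1)"
proof -
  define K where "K = \<bar>L\<bar> + \<bar>s\<bar> + 1"
  define X1 where "X1 u = p powi (tri (L - s - 2 * u) + u + (M - (L - s - 2 * u))) * qbin p (M + b - 1) u
      * qbin p (L - s - 2 * u - 1) (M - (L - s - 2 * u)) * qbin p (M - b) (u + s)" for u
  define X2 where "X2 u = p powi (tri (L - s - 2 * u) + u + (M - b)) * qbin p (M + b - 1) u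
      * qbin p (L - s - 2 * u) (M - 1 - (L - s - 2 * u)) * qbin p (M - b) (u + s - 1)" for u
  define Y1 where "Y1 u = p powi (tri (L - (s - 1) - 2 * u) + u + (M - (L - (s - 1) - 2 * u))) * qbin p (M + b - 1) u
      * qbin p (L - (s - 1) - 2 * u - 1) (M - (L - (s - 1) - 2 * u)) * qbin p (M - b) (u + (s - 1))" for u
  define Y2 where "Y2 u = p powi (tri (L - (s - 1) - 2 * u) + u + (M + b - 1)) * qbin p (M + b - 1) (u - 1)
      * qbin p (L - (s - 1) - 2 * u) (M - 1 - (L - (s - 1) - 2 * u)) * qbin p (M - b) (u + (s - 1))" for u
  have X: "rtri_term p L M s b u - rtri_term p L (M - 1) s b u - p powi (M + b + 1) * rtri_term p (L - 1) M (s + 1) b (u - 1)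
      = X1 u + X2 u" if "u \<ge> 0" for u
  proof -
    define n where "n = L - s - 2 * u"
    define P where "P = p powi (tri n + u)"
    have "rtri_term p L M s b u - p powi (M + b + 1) * rtri_term p (L - 1) M (s + 1) b (u - 1)
       = P * qbin p n (M - n) * qbin p (M + b - 1) u * qbin p (M - b) (u + s)"
      using rtri_term_raise_left[of M b L s u] assms unfolding n_def P_def by simp
    moreover have "rtri_term p L (M - 1) s b u
       = P * qbin p n (M - 1 - n) * qbin p (M + b - 1) u * qbin p (M - b - 1) (u + s)"
      unfolding rtri_term_def n_def P_def by (simp add: algebra_simps)
    moreover have "qbin p n (M - n) * qbin p (M - b) (u + s)
       = (qbin p n (M - 1 - n) + p powi (M - n) * qbin p (n - 1) (M - n)) * qbin p (M - b) (u + s)"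
    \<comment> \<open>At the exceptional point of Pascal's rule \<open>M - b\<close> is negative, so
      the other factor is zero.\<close>
    proof (cases "M = 0 \<and> n = 0")
      case False
      then have c: "n \<noteq> 0 \<or> M - n \<noteq> 0" by auto
      have e: "M - n - 1 = M - 1 - n" by simp
      show ?thesis unfolding qbin_pascal'[OF c] e ..
    qed (use assms in simp)
    moreover have "qbin p (M - b - 1) (u + s) = qbin p (M - b) (u + s) - p powi (M - b) * qbin p (M - b) (u + s - 1)"
      using qbin_pascal[of "M - b" "u + s"] assms that by (simp add: algebra_simps)
    moreover have "X1 u = P * p powi (M - n) * qbin p (M + b - 1) u * qbin p (n - 1) (M - n) * qbin p (M - b) (u + s)"
      "X2 u = P * p powi (M - b) * qbin p (M + b - 1) u * qbin p n (M - 1 - n) * qbin p (M - b) (u + s - 1)"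
      unfolding X1_def X2_def P_def n_def pw_add by simp_all
    ultimately show ?thesis by algebra
  qed
  have Y: "rtri_term p L M (s - 1) (b - 1) u - rtri_term p L (M - 1) (s - 1) (b - 1) u
      - p powi (M - b + 1) * rtri_term p (L - 1) M (s - 2) (b - 1) u = Y1 u + Y2 u" if "u \<ge> 0" for u
  proof -
    define n where "n = L - (s - 1) - 2 * u"
    define P where "P = p powi (tri n + u)"
    have "rtri_term p L M (s - 1) (b - 1) u - p powi (M - b + 1) * rtri_term p (L - 1) M (s - 2) (b - 1) u
       = P * qbin p n (M - n) * qbin p (M + b - 1) u * qbin p (M - b) (u + (s - 1))"
      using rtri_term_raise_right[of "s - 1" u L M "b - 1"] assms that unfolding n_def P_def by (simp add: algebra_simps)
    moreover have "rtri_term p L (M - 1) (s - 1) (b - 1) u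
       = P * qbin p n (M - 1 - n) * qbin p (M + b - 2) u * qbin p (M - b) (u + (s - 1))"
      unfolding rtri_term_def n_def P_def by (simp add: algebra_simps)
    moreover have "qbin p n (M - n) * qbin p (M - b) (u + (s - 1))
       = (qbin p n (M - 1 - n) + p powi (M - n) * qbin p (n - 1) (M - n)) * qbin p (M - b) (u + (s - 1))"
    proof (cases "M = 0 \<and> n = 0")
      case False
      then have c: "n \<noteq> 0 \<or> M - n \<noteq> 0" by auto
      have e: "M - n - 1 = M - 1 - n" by simp
      show ?thesis unfolding qbin_pascal'[OF c] e ..
    qed (use assms in simp)
    moreover have "qbin p (M - b) (u + (s - 1)) * qbin p (M + b - 2) u
       = qbin p (M - b) (u + (s - 1)) * (qbin p (M + b - 1) u - p powi (M + b - 1) * qbin p (M + b - 1) (u - 1))"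
    \<comment> \<open>If \<open>M < b\<close> the common factor vanishes; otherwise
      \<open>M + b - 1 > 0\<close>, so Pascal's rule applies for every \<open>u\<close>.\<close>
    proof (cases "M < b")
      case False
      then show ?thesis using qbin_pascal[of "M + b - 1" u] assms by (simp add: algebra_simps)
    qed simp
    moreover have "Y1 u = P * p powi (M - n) * qbin p (M + b - 1) u * qbin p (n - 1) (M - n) * qbin p (M - b) (u + (s - 1))"
      "Y2 u = P * p powi (M + b - 1) * qbin p (M + b - 1) (u - 1) * qbin p n (M - 1 - n) * qbin p (M - b) (u + (s - 1))"
      unfolding Y1_def Y2_def P_def n_def pw_add by simp_all
    ultimately show ?thesis by algebra
  qed
  have tri_Suc: "tri (n + 1) = tri n + n + 1" for n
    using tri_rec[of "n + 1"] by simp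
  have XY1: "p powi b * X2 u = Y1 u" for u
  proof -
    define n where "n = L - s - 2 * u"
    have n': "L - (s - 1) - 2 * u = n + 1" by (simp add: n_def)
    have "p powi b * p powi (tri n + u + (M - b)) = p powi (tri (n + 1) + u + (M - (n + 1)))"
      unfolding pw_add[symmetric] tri_Suc by (rule arg_cong[of _ _ "\<lambda>e. p powi e"]) simp
    moreover have "M - 1 - n = M - (n + 1)" "n + 1 - 1 = n" "u + (s - 1) = u + s - 1" by auto
    ultimately show ?thesis
      unfolding X2_def Y1_def n' n_def[symmetric] by (simp only: mult.assoc[symmetric])
  qed
  have XY2: "p powi b * X1 (u - 1) = Y2 u" for u
  proof -
    define n where "n = L - (s - 1) - 2 * u"
    have n': "L - s - 2 * (u - 1) = n + 1" by (simp add: n_def)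
    have "p powi b * p powi (tri (n + 1) + (u - 1) + (M - (n + 1))) = p powi (tri n + u + (M + b - 1))"
      unfolding pw_add[symmetric] tri_Suc by (rule arg_cong[of _ _ "\<lambda>e. p powi e"]) simp
    moreover have "M - (n + 1) = M - 1 - n" "n + 1 - 1 = n" "u - 1 + s = u + (s - 1)" by auto
    ultimately show ?thesis
      unfolding X1_def Y2_def n' n_def[symmetric] by (simp only: mult.assoc[symmetric])
  qed
  have shift: "(\<Sum>u = 0..K. rtri_term p (L - 1) M (s + 1) b (u - 1)) = (\<Sum>u = 0..K. rtri_term p (L - 1) M (s + 1) b u)"
    by (rule sum_int_shift) (auto simp: K_def intro: rtri_term_eq_0)
  have shift1: "(\<Sum>u = 0..K. X1 (u - 1)) = (\<Sum>u = 0..K. X1 u)"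
    by (rule sum_int_shift) (auto simp: K_def X1_def)
  have "rtri p L M s b - rtri p L (M - 1) s b - p powi (M + b + 1) * rtri p (L - 1) M (s + 1) b
     = (\<Sum>u = 0..K. X1 u + X2 u)"
  proof -
    have "(\<Sum>u = 0..K. X1 u + X2 u) = (\<Sum>u = 0..K. rtri_term p L M s b u - rtri_term p L (M - 1) s b u
        - p powi (M + b + 1) * rtri_term p (L - 1) M (s + 1) b (u - 1))"
      by (intro sum.cong refl) (simp add: X)
    also have "\<dots> = (\<Sum>u = 0..K. rtri_term p L M s b u) - (\<Sum>u = 0..K. rtri_term p L (M - 1) s b u)
        - p powi (M + b + 1) * (\<Sum>u = 0..K. rtri_term p (L - 1) M (s + 1) b u)"
      unfolding shift[symmetric] by (simp add: sum_subtractf sum_distrib_left)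
    finally show ?thesis by (simp add: rtri_eq_sum[of _ _ K] K_def)
  qed
  also have "p powi b * \<dots> = (\<Sum>u = 0..K. Y1 u + Y2 u)"
    using shift1[symmetric] by (simp add: sum.distrib distrib_left sum_distrib_left XY1 XY2)
  also have "\<dots> = rtri p L M (s - 1) (b - 1) - rtri p L (M - 1) (s - 1) (b - 1)
     - p powi (M - b + 1) * rtri p (L - 1) M (s - 2) (b - 1)"
    by (simp add: rtri_eq_sum[of _ _ K] sum_subtractf sum_distrib_left Y[symmetric] K_def)
  finally show ?thesis .
qed

end

section \<open>The Burge transformation\<close>

text \<open>Since \<open>rtri x (L - i)\<close> carries the factor x^((L - i - a)/2), the weight
  i^2/2 of the transformation appears here as \<open>tri i\<close>, and b^2/2 on its other side as
  \<open>tri b\<close>.\<close>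

definition burge_sum :: "'a::field \<Rightarrow> int \<Rightarrow> int \<Rightarrow> int \<Rightarrow> int \<Rightarrow> 'a" where
  "burge_sum x L M a b = (\<Sum>i = 0..M. x powi tri i * qbin x L (M - i) * rtri x (L - i) i a b)"

context nonroot begin

lemma qbin_mult_commute: "qbin p x y * qbin p (x + y) z = qbin p x z * qbin p (x + z) y"
proof (cases "x < 0 \<or> y < 0 \<or> z < 0")
  case False
  then obtain i j k where "x = int i" "y = int j" "z = int k"
    by (metis nonneg_int_cases not_less)
  then show ?thesis
    by (simp add: qbin_of_nat flip: of_nat_add) (simp add: ac_simps)
qed auto

text \<open>For \<open>b = 0\<close> the double sum over \<open>i\<close> and \<open>u\<close> is
  reorganised by \<open>k = L - a - i - u\<close>. At fixed \<open>k\<close> the sum over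
  \<open>u\<close> is a q-Pfaff--Saalschuetz sum, and its value is the \<open>k\<close>-th term of
  the trinomial on the right.\<close>

lemma burge_sum_right_0:
  assumes "a \<ge> 0"
  shows "burge_sum p L M a 0 = rtri p L M a 0"
proof -
  define K where "K = \<bar>L\<bar> + a"
  define f where "f i u = p powi tri i * qbin p L (M - i) * rtri_term p (L - i) i a 0 u" for i u
  have "burge_sum p L M a 0 = (\<Sum>i = 0..M. \<Sum>u = 0..K. f i u)"
    unfolding burge_sum_def f_def sum_distrib_left[symmetric]
    by (intro sum.cong refl arg_cong2[where f = "(*)"] rtri_eq_sum) (use assms in \<open>auto simp: K_def\<close>)
  also have "\<dots> = (\<Sum>u = 0..K. \<Sum>i = 0..M. f i u)"
    by (rule sum.swap)
  also have "\<dots> = (\<Sum>u = 0..K. \<Sum>k = 0..K. f (L - a - k - u) u)"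
  proof (rule sum.cong[OF refl])
    fix u assume u: "u \<in> {0..K}"
    have 1: "f i u = 0" if "i < 0 \<or> i > M" for i
      using that by (auto simp: f_def rtri_term_eq_0)
    have 2: "f i u = 0" if "L - a - u - i < 0 \<or> L - a - u - i > K" "0 \<le> i" for i
    proof -
      have "2 * u > L - i - a" using that u assms by (auto simp: K_def)
      then show ?thesis unfolding f_def by (simp add: rtri_term_eq_0(2))
    qed
    have out: "f i u = 0" if "i < 0 \<or> i > M \<or> L - a - u - i < 0 \<or> L - a - u - i > K" for i
      using 1 2 that by (cases "i < 0") auto
    show "(\<Sum>i = 0..M. f i u) = (\<Sum>k = 0..K. f (L - a - k - u) u)"
      by (rule sum.reindex_bij_witness_not_neutral[where i = "\<lambda>k. L - a - k - u" and j = "\<lambda>i. L - a - u - i"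
        and S' = "{0..M} - {L - a - u - K..L - a - u}" and T' = "{0..K} - {L - a - u - M..L - a - u}"])
       (auto intro!: out)
  qed
  also have "\<dots> = (\<Sum>k = 0..K. \<Sum>u = 0..K. f (L - a - k - u) u)"
    by (rule sum.swap)
  also have "\<dots> = (\<Sum>k = 0..K. rtri_term p L M a 0 k)"
  proof (intro sum.cong refl)
    fix k assume k: "k \<in> {0..K}"
    define c where "c = L - a - k"
    show "(\<Sum>u = 0..K. f (L - a - k - u) u) = rtri_term p L M a 0 k"
    \<comment> \<open>Here \<open>c - k\<close> is \<open>L - a - 2 * k\<close>, the first index of
      the right-hand term, and also an argument of a Gaussian coefficient on the left, so both sides
      vanish if it is negative. Otherwise \<open>c + a \<ge> 0\<close>, as the natural number
      parameter of \<open>saalschuetz\<close> demands.\<close>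
    proof (cases "c < k")
      case True
      have "f (L - a - k - u) u = 0" for u
      proof -
        have "c - u < 0 \<or> 2 * u > L - (c - u) - a \<or> c - u - (k - u) < 0" using True by linarith
        moreover have "L - (c - u) - a - 2 * u = k - u" by (simp add: c_def)
        ultimately show ?thesis
          unfolding f_def c_def[symmetric] by (auto simp: rtri_term_eq_0 rtri_term_def)
      qed
      then show ?thesis using True by (simp add: rtri_term_eq_0 c_def)
    next
      case False
      define g where "g r = p powi ((M - c + k - r) * (M - r)) * qbin p (M - c + k - r) (k - (M - c + k) + r)
            * qbin p (M - r) (c + a - M + r) * qbin p (k + (c + a)) r" for r
      have e: "tri (c - u) + (tri (k - u) + u) = tri (c - k) + k + (k - u) * (c - u)" for u
      proof -
        have "2 * (tri (c - u) + (tri (k - u) + u)) = 2 * (tri (c - k) + k + (k - u) * (c - u))"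
          unfolding distrib_left two_tri by (simp add: algebra_simps)
        then show ?thesis by simp
      qed
      have fg: "f (L - a - k - u) u = p powi (tri (c - k) + k) * qbin p (c - k) k * g (u + M - c)" for u
      proof -
        have n: "L - (c - u) - a - 2 * u = k - u" by (simp add: c_def)
        have "f (L - a - k - u) u = p powi tri (c - u) * qbin p L (M - (c - u)) *
            (p powi (tri (k - u) + u) * qbin p (k - u) (c - u - (k - u)) * qbin p (c - u) u * qbin p (c - u) (u + a))"
          unfolding f_def c_def[symmetric] rtri_term_def n by simp
        also have "\<dots> = p powi (tri (c - u) + (tri (k - u) + u)) * (qbin p (k - u) (c - k) * qbin p (c - u) u)
            * qbin p L (M - (c - u)) * qbin p (c - u) (u + a)"
          unfolding pw_add by (simp add: algebra_simps)
        \<comment> \<open>This exchange isolates \<open>qbin p k (c - k)\<close>, which does not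
          depend on \<open>u\<close>, and leaves exactly three coefficients under the sum.\<close>
        also have "qbin p (k - u) (c - k) * qbin p (c - u) u = qbin p (k - u) u * qbin p k (c - k)"
          using qbin_mult_commute[of "k - u" "c - k" u] by simp
        also have "p powi (tri (c - u) + (tri (k - u) + u)) * (qbin p (k - u) u * qbin p k (c - k))
            * qbin p L (M - (c - u)) * qbin p (c - u) (u + a)
          = p powi (tri (c - k) + k) * qbin p (c - k) k * g (u + M - c)"
          unfolding e pw_add g_def using qbin_commute[of p k "c - k"]
          by (simp add: algebra_simps c_def)
        finally show ?thesis .
      qed
      have "(\<Sum>u = 0..K. f (L - a - k - u) u)
          = p powi (tri (c - k) + k) * qbin p (c - k) k * (\<Sum>u = 0..K. g (u + M - c))"
        unfolding fg sum_distrib_left ..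
      \<comment> \<open>The substitution \<open>r = u + M - c\<close> moves the ends of the range. A
        negative \<open>r\<close> kills the last factor of \<open>g\<close>, and a negative
        \<open>u\<close> the second argument of its first coefficient.\<close>
      also have "(\<Sum>u = 0..K. g (u + M - c)) = (\<Sum>r = 0..M - c + K. g r)"
      proof (rule sum.reindex_bij_witness_not_neutral[where i = "\<lambda>r. r - M + c" and j = "\<lambda>u. u + M - c"
            and S' = "{0..K} \<inter> {..<c - M}" and T' = "{0..M - c + K} \<inter> {..<M - c}"])
        fix u assume "u \<in> {0..K} \<inter> {..<c - M}" then show "g (u + M - c) = 0" by (simp add: g_def)
      next
        fix r assume "r \<in> {0..M - c + K} \<inter> {..<M - c}" then show "g r = 0" by (simp add: g_def)
      qed auto
      also have "\<dots> = qbin p (M - c + k) c * qbin p M (k + a)"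
      proof -
        have nn: "int (nat k) = k" "int (nat (c + a)) = c + a" using k False assms by auto
        have "(\<Sum>r = 0..M - c + K. g r) = qbin p (M - c + k) (k + M - (M - c + k)) * qbin p M (c + a + (M - c + k) - M)"
          using saalschuetz[of "M - c + k" "M - c + K" M "nat k" "nat (c + a)", unfolded nn] k
          unfolding g_def by simp
        also have "\<dots> = qbin p (M - c + k) c * qbin p M (k + a)"
          by (simp add: algebra_simps)
        finally show ?thesis .
      qed
      also have "p powi (tri (c - k) + k) * qbin p (c - k) k * (qbin p (M - c + k) c * qbin p M (k + a))
          = rtri_term p L M a 0 k"
      proof -
        have "qbin p (c - k) k * qbin p c (M - c + k) = qbin p (c - k) (M - c + k) * qbin p M k"
          using qbin_mult_commute[of "c - k" k "M - c + k"] by simp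
        moreover have n: "L - a - 2 * k = c - k" "M - (c - k) = M - c + k" by (auto simp: c_def)
        ultimately show ?thesis
          unfolding rtri_term_def n using qbin_commute[of p c "M - c + k"] by (simp add: mult.assoc) 
      qed
      finally show ?thesis .
    qed
  qed
  also have "\<dots> = rtri p L M a 0"
    by (rule rtri_eq_sum[symmetric]) (use assms in \<open>auto simp: K_def\<close>)
  finally show ?thesis .
qed

text \<open>Pascal's rule on \<open>qbin p L (M - i)\<close> leaves p^(M-i), and p^(M+e) = p^(M-i)
  p^(i+e). Thus a contiguous relation of \<open>rtri\<close> with coefficient p^(i+e) lifts to the
  sum. \<open>e\<close> and \<open>a'\<close> remain free because the two sides of
  \<open>rtri_raise\<close> need different values.\<close>

lemma burge_sum_diff:
  assumes "L \<noteq> 0"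
  shows "burge_sum p L M a b - burge_sum p L (M - 1) a b - p powi (M + e) * burge_sum p (L - 1) M a' b
    = (\<Sum>i = 0..M. p powi (tri i + (M - i)) * qbin p (L - 1) (M - i)
        * (rtri p (L - i) i a b - p powi (i + e) * rtri p (L - i - 1) i a' b))"
proof -
  have 1: "burge_sum p L (M - 1) a b = (\<Sum>i = 0..M. p powi tri i * qbin p L (M - 1 - i) * rtri p (L - i) i a b)"
    unfolding burge_sum_def by (rule sum.mono_neutral_left) auto
  have 2: "p powi tri i * qbin p L (M - i) * rtri p (L - i) i a b - p powi tri i * qbin p L (M - 1 - i) * rtri p (L - i) i a b
      - p powi (M + e) * (p powi tri i * qbin p (L - 1) (M - i) * rtri p (L - 1 - i) i a' b)
     = p powi (tri i + (M - i)) * qbin p (L - 1) (M - i)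
        * (rtri p (L - i) i a b - p powi (i + e) * rtri p (L - i - 1) i a' b)" for i
  proof -
    have a: "M - i - 1 = M - 1 - i" "L - 1 - i = L - i - 1" by auto
    have b: "qbin p L (M - i) - qbin p L (M - 1 - i) = p powi (M - i) * qbin p (L - 1) (M - i)"
      using qbin_pascal'[of L "M - i"] assms unfolding a by simp
    have c: "p powi (M + e) = p powi (M - i) * p powi (i + e)"
      unfolding pw_add[symmetric] by simp
    have "p powi tri i * qbin p L (M - i) * rtri p (L - i) i a b - p powi tri i * qbin p L (M - 1 - i) * rtri p (L - i) i a b
      = p powi tri i * (qbin p L (M - i) - qbin p L (M - 1 - i)) * rtri p (L - i) i a b"
      by (simp add: algebra_simps)
    then show ?thesis unfolding a b c pw_add[of "tri i"] by (simp add: algebra_simps)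
  qed
  show ?thesis
    unfolding 2[symmetric] unfolding 1 unfolding burge_sum_def
    by (simp only: sum_subtractf sum_distrib_left)
qed

lemma burge_sum_raise:
  assumes "L \<noteq> 0" "a \<ge> 1" "b \<ge> 1"
  shows "burge_sum p L M a b - burge_sum p L (M - 1) a b - p powi (M + b + 1) * burge_sum p (L - 1) M (a + 1) b
    = burge_sum p L M a (b - 1) - burge_sum p L (M - 1) a (b - 1)
      - p powi (M - b + 1) * burge_sum p (L - 1) M (a - 1) (b - 1)"
proof -
  have 1: "rtri p (L - i) i a b - p powi (i + (b + 1)) * rtri p (L - i - 1) i (a + 1) b
     = rtri p (L - i) i a (b - 1) - p powi (i + (1 - b)) * rtri p (L - i - 1) i (a - 1) (b - 1)" for i
    using rtri_raise[of a b "L - i" i] assms by (simp add: algebra_simps)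
  show ?thesis
    using burge_sum_diff[OF assms(1), of M a b "b + 1" "a + 1"]
      burge_sum_diff[OF assms(1), of M a "b - 1" "1 - b" "a - 1"]
    unfolding 1 by (simp add: algebra_simps)
qed

lemma burge_sum_eq_0: "L < 0 \<or> L < a \<or> M < 0 \<Longrightarrow> burge_sum p L M a b = 0"
proof -
  assume *: "L < 0 \<or> L < a \<or> M < 0"
  have "rtri p (L - i) i a b = 0" if "i \<in> {0..M}" for i
    using * that by (auto intro: rtri_eq_0)
  then show ?thesis unfolding burge_sum_def by (simp add: sum.neutral)
qed

text \<open>Warnaar's Burge-type transformation. Lemmas \<open>burge_sum_raise\<close> and \<open>rtri_raise_diff\<close> give both
  sides the same recurrence, which trades \<open>b\<close> for \<open>b - 1\<close>. The restriction \<open>b \<le> a\<close> keeps the induction inside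
  the range in which these recurrences hold; the identity fails for \<open>a < 0 < b\<close>.\<close>

lemma burge_transform_nonneg:
  assumes "0 \<le> b" "b \<le> a"
  shows "burge_sum p L M a b = p powi tri b * rtri p L M (a + b) b"
  using assms
proof (induction b arbitrary: a L M rule: int_ge_induct)
  case base
  then show ?case using burge_sum_right_0[of a L M] by (simp add: tri_def)
next
  case (step b)
  note IH = step.IH
  define B where "B = b + 1"
  have B: "B \<ge> 1" "b = B - 1" using step.hyps by (auto simp: B_def)
  \<comment> \<open>The recurrence at \<open>(L, M, a, B)\<close> refers to \<open>M - 1\<close>, to
    \<open>(L - 1, a + 1)\<close>, and to \<open>B - 1\<close> with first index \<open>a\<close> or
    \<open>a - 1\<close>. Hence nested inductions on bounds for \<open>L\<close> and
    \<open>M\<close>, inside the one on \<open>b\<close>; \<open>a - 1 \<ge> B - 1\<close> keeps the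
    hypothesis applicable.\<close>
  have "burge_sum p L M a B = p powi tri B * rtri p L M (a + B) B" if "L < int l" "a \<ge> B" for l
    using that
  proof (induction l arbitrary: L M a)
    case 0
    then show ?case by (simp add: burge_sum_eq_0 rtri_eq_0)
  next
    case (Suc l)
    note IHL = Suc.IH
    have aL: "a \<ge> B" "L - 1 < int l" using Suc.prems by auto
    show ?case
    proof (cases "L \<le> 0")
      case True
      then have "L < a" using aL B by simp
      then show ?thesis using B by (simp add: burge_sum_eq_0 rtri_eq_0)
    next
      case False
      have "burge_sum p L M a B = p powi tri B * rtri p L M (a + B) B" if "M < int k" for k
        using that
      proof (induction k arbitrary: M)
        case 0
        then show ?case by (simp add: burge_sum_eq_0 rtri_eq_0)
      next
        case (Suc k)
        have A1: "burge_sum p L (M - 1) a B = p powi tri B * rtri p L (M - 1) (a + B) B"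
          using Suc.prems by (intro Suc.IH) simp
        have A2: "burge_sum p (L - 1) M (a + 1) B = p powi tri B * rtri p (L - 1) M (a + B + 1) B"
          using IHL[of "L - 1" "a + 1" M] aL by (simp add: algebra_simps)
        have A3: "burge_sum p L M a (B - 1) = p powi tri (B - 1) * rtri p L M (a + B - 1) (B - 1)" for M
          using IH[of a L M] aL B by (simp add: algebra_simps)
        have A4: "burge_sum p (L - 1) M (a - 1) (B - 1) = p powi tri (B - 1) * rtri p (L - 1) M (a + B - 2) (B - 1)"
          using IH[of "a - 1" "L - 1" M] aL B by (simp add: algebra_simps)
        have t: "p powi tri B = p powi tri (B - 1) * p powi B"
          unfolding pw_add[symmetric] using tri_rec[of B] by simp
        define X where "X = rtri p L M (a + B) B - rtri p L (M - 1) (a + B) B - p powi (M + B + 1) * rtri p (L - 1) M (a + B + 1) B"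
        have "burge_sum p L M a B - p powi tri B * rtri p L (M - 1) (a + B) B
            - p powi (M + B + 1) * (p powi tri B * rtri p (L - 1) M (a + B + 1) B)
          = p powi tri (B - 1) * (rtri p L M (a + B - 1) (B - 1) - rtri p L (M - 1) (a + B - 1) (B - 1)
              - p powi (M - B + 1) * rtri p (L - 1) M (a + B - 2) (B - 1))"
          using burge_sum_raise[of L a B M] False aL B unfolding A1 A2 A3 A4 by (simp add: algebra_simps)
        also have "\<dots> = p powi tri (B - 1) * (p powi B * X)"
          unfolding X_def using rtri_raise_diff[of "a + B" B L M] aL B by (simp only:)
        also have "\<dots> = p powi tri B * X" unfolding t by simp
        finally show ?case unfolding X_def by (simp add: algebra_simps)
      qed
      from this[of "nat (M + 1)"] show ?thesis by simp
    qed
  qed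
  from this[of "nat (L + 1)"] step.prems show ?case by (simp add: B_def)
qed

end

section \<open>The limiting transformation\<close>

text \<open>The Andrews--Baxter trinomial coefficient divided by \<open>(x; x)\<^sub>L\<close>, for integral \<open>L\<close>
  (lemma \<open>qtrinom2_eq_tsum\<close>).\<close>

definition tsum_term :: "'a::field \<Rightarrow> int \<Rightarrow> int \<Rightarrow> int \<Rightarrow> 'a" where
  "tsum_term x L s k = x powi (k * (k + s)) * inv_qpoch x k * inv_qpoch x (k + s) * inv_qpoch x (L - 2 * k - s)"

definition tsum :: "'a::field \<Rightarrow> int \<Rightarrow> int \<Rightarrow> 'a" where
  "tsum x L s = (\<Sum>k = 0..\<bar>L\<bar>. tsum_term x L s k)"

lemma inv_qpoch_neg [simp]: "n < 0 \<Longrightarrow> inv_qpoch x n = 0"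
  by (simp add: inv_qpoch_def)

lemma tsum_term_eq_0: "k < 0 \<or> k > L \<or> k + s < 0 \<or> 2 * k + s > L \<Longrightarrow> tsum_term x L s k = 0"
proof -
  assume "k < 0 \<or> k > L \<or> k + s < 0 \<or> 2 * k + s > L"
  then have "k < 0 \<or> k + s < 0 \<or> L - 2 * k - s < 0" by linarith
  then show ?thesis by (auto simp: tsum_term_def)
qed

lemma tsum_eq_sum:
  assumes "L \<le> K"
  shows "tsum x L s = (\<Sum>k = 0..K. tsum_term x L s k)"
  unfolding tsum_def
  by (rule sum.reindex_bij_witness_not_neutral[where i = id and j = id
        and S' = "{K + 1..\<bar>L\<bar>}" and T' = "{\<bar>L\<bar> + 1..K}"])
    (use assms in \<open>auto intro: tsum_term_eq_0\<close>)

lemma tsum_eq_0: "L < 0 \<or> L < s \<Longrightarrow> tsum x L s = 0"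
proof -
  assume *: "L < 0 \<or> L < s"
  have "tsum_term x L s k = 0" if "k \<in> {0..\<bar>L\<bar>}" for k
    using that * by (intro tsum_term_eq_0) auto
  then show ?thesis by (simp add: tsum_def)
qed

text \<open>\<open>rtri x i\<close> carries x^((i - a)/2); removing it from the weight i^2/2 leaves
  \<open>tri (i - 1)\<close>, and correspondingly a^2/2 becomes \<open>tri (a - 1)\<close> in the
  evaluation.\<close>

definition dual_sum :: "'a::field \<Rightarrow> int \<Rightarrow> int \<Rightarrow> int \<Rightarrow> 'a" where
  "dual_sum x L a b = (\<Sum>i = 0..L. x powi tri (i - 1) * rtri x i (L - i) a b)"

context nonroot begin

text \<open>Creative telescoping: the difference of the two summands is
  \<open>G k - G (k + 1)\<close>. The relation is the counterpart of \<open>dual_sum_raise\<close>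
  on the trinomial side.\<close>

lemma tsum_raise:
  "(1 - p powi L) * (tsum p L (s - 1) - tsum p L s)
   = p powi (L - s + 1) * tsum p (L - 1) (s - 2) - p powi (L + s) * tsum p (L - 1) (s + 1)"
proof -
  define K where "K = \<bar>L\<bar> + \<bar>s\<bar> + 1"
  \<comment> \<open>The last summand of \<open>G\<close> reproduces the term with
    \<open>s + 1\<close> upon passing to \<open>k + 1\<close>. Every summand contains a reciprocal
    of index \<open>k - 1\<close>, so \<open>G 0 = 0\<close>; at \<open>K + 1\<close> the
    reciprocals with \<open>- 2 * k\<close> vanish.\<close>
  define G where "G k = p powi (L - 2 * k - s + 1 + k * (k + s - 1)) * inv_qpoch p (k - 1) * inv_qpoch p (k + s - 1) * inv_qpoch p (L - 2 * k - s + 1)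
     + p powi (k * (k + s - 1)) * inv_qpoch p (k - 1) * inv_qpoch p (k + s - 1) * inv_qpoch p (L - 2 * k - s)
     - p powi (L + s) * tsum_term p (L - 1) (s + 1) (k - 1)" for k
  have "(1 - p powi L) * (tsum_term p L (s - 1) k - tsum_term p L s k)
     - (p powi (L - s + 1) * tsum_term p (L - 1) (s - 2) k - p powi (L + s) * tsum_term p (L - 1) (s + 1) k)
     = G k - G (k + 1)" for k
  proof -
    \<comment> \<open>The lowest powers of \<open>p\<close> and the reciprocals of highest index are
      chosen as unknowns. Everything else is then a product of them and of factors
      \<open>1 - ...\<close>, and the claim becomes a polynomial identity without division.\<close>
    define x y z Q where "x = p powi k" and "y = p powi (k + s - 1)" and "z = p powi (L - 2 * k - s - 1)"
      and "Q = p powi (k * (k + s - 2))"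
    define A B C where "A = inv_qpoch p k" and "B = inv_qpoch p (k + s)" and "C = inv_qpoch p (L - 2 * k - s + 1)"
    have p1: "p powi (n + 1) = p * p powi n" for n by (simp add: pw_add)
    have y1: "p powi (k + s) = p * y" using p1[of "k + s - 1"] by (simp add: y_def)
    have z1: "p powi (L - 2 * k - s) = p * z" using p1[of "L - 2 * k - s - 1"] by (simp add: z_def)
    have z2: "p powi (L - 2 * k - s + 1) = p * (p * z)" using p1[of "L - 2 * k - s"] z1 by simp
    have A': "inv_qpoch p (k - 1) = A * (1 - x)"
      using inv_qpoch_rec[of k] by (simp add: A_def x_def)
    have B1: "inv_qpoch p (k + s - 1) = B * (1 - p * y)"
      using inv_qpoch_rec[of "k + s"] by (simp add: B_def y1)
    have B2: "inv_qpoch p (k + s - 2) = B * (1 - p * y) * (1 - y)"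
      using inv_qpoch_rec[of "k + s - 1"] by (simp add: B1 y_def)
    have C1: "inv_qpoch p (L - 2 * k - s) = C * (1 - p * (p * z))"
      using inv_qpoch_rec[of "L - 2 * k - s + 1"] by (simp add: C_def z2)
    have C2: "inv_qpoch p (L - 2 * k - s - 1) = C * (1 - p * (p * z)) * (1 - p * z)"
      using inv_qpoch_rec[of "L - 2 * k - s"] by (simp add: C1 z1)
    have C3: "inv_qpoch p (L - 2 * k - s - 2) = C * (1 - p * (p * z)) * (1 - p * z) * (1 - z)"
    proof -
      have "L - 2 * k - s - 1 - 1 = L - 2 * k - s - 2" by simp
      then show ?thesis using inv_qpoch_rec[of "L - 2 * k - s - 1"] unfolding C2 z_def by (simp only:)
    qed
    have Q1: "p powi (k * (k + s - 1)) = Q * x"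
      unfolding Q_def x_def pw_add[symmetric] by (simp add: algebra_simps)
    have Q2: "p powi (k * (k + s)) = Q * x * x"
      unfolding Q_def x_def pw_add[symmetric] by (simp add: algebra_simps)
    have Q3: "p powi ((k + 1) * (k + s)) = Q * x * x * (p * y)"
      unfolding y1[symmetric] Q2[symmetric] pw_add[symmetric] by (simp add: algebra_simps)
    have PL: "p powi L = p * z * x * (p * y)"
      unfolding y1[symmetric] z1[symmetric] x_def pw_add[symmetric] by (simp add: algebra_simps)
    have PLs: "p powi (L - s + 1) = p * (p * z) * x * x"
      unfolding z2[symmetric] x_def pw_add[symmetric] by (simp add: algebra_simps)
    have t1: "tsum_term p L (s - 1) k = Q * x * A * (B * (1 - p * y)) * C"
      unfolding tsum_term_def Q1[symmetric] B1[symmetric] A_def C_def by (simp add: algebra_simps)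
    have t2: "tsum_term p L s k = Q * x * x * A * B * (C * (1 - p * (p * z)))"
      unfolding tsum_term_def Q2[symmetric] C1[symmetric] A_def B_def by (simp add: algebra_simps)
    have t3: "tsum_term p (L - 1) (s - 2) k = Q * A * (B * (1 - p * y) * (1 - y)) * C"
      unfolding tsum_term_def Q_def B2[symmetric] A_def C_def by (simp add: algebra_simps)
    have t4: "p powi (L + s) * tsum_term p (L - 1) (s + 1) (k - 1) = p * z * (p * y) * (Q * x * x) * (A * (1 - x)) * B * (C * (1 - p * (p * z)))"
    proof -
      have "p powi (L + s) * p powi ((k - 1) * (k - 1 + (s + 1))) = p * z * (p * y) * (Q * x * x)"
        unfolding y1[symmetric] z1[symmetric] Q2[symmetric] pw_add[symmetric]
        by (rule arg_cong[of _ _ "\<lambda>e. p powi e"]) (simp add: algebra_simps)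
      then have "p powi (L + s) * tsum_term p (L - 1) (s + 1) (k - 1) = p * z * (p * y) * (Q * x * x)
          * inv_qpoch p (k - 1) * inv_qpoch p (k - 1 + (s + 1)) * inv_qpoch p (L - 1 - 2 * (k - 1) - (s + 1))"
        by (simp only: tsum_term_def flip: mult.assoc)
      moreover have "k - 1 + (s + 1) = k + s" "L - 1 - 2 * (k - 1) - (s + 1) = L - 2 * k - s" by auto
      ultimately show ?thesis by (simp only: A' C1 B_def)
    qed
    have g1: "G k = p * (p * z) * (Q * x) * (A * (1 - x)) * (B * (1 - p * y)) * C
       + Q * x * (A * (1 - x)) * (B * (1 - p * y)) * (C * (1 - p * (p * z)))
       - p * z * (p * y) * (Q * x * x) * (A * (1 - x)) * B * (C * (1 - p * (p * z)))"
      unfolding G_def t4 pw_add[of "L - 2 * k - s + 1"] z2 Q1 A' B1 C1 C_def ..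
    have g2: "G (k + 1) + p powi (L + s) * tsum_term p (L - 1) (s + 1) k
       = z * (Q * x * x * (p * y)) * A * B * (C * (1 - p * (p * z)) * (1 - p * z))
        + Q * x * x * (p * y) * A * B * (C * (1 - p * (p * z)) * (1 - p * z) * (1 - z))"
    proof -
      have "L - 2 * (k + 1) - s + 1 = L - 2 * k - s - 1" "k + 1 + s - 1 = k + s" "k + 1 - 1 = k"
        "L - 2 * (k + 1) - s = L - 2 * k - s - 2" by auto
      then show ?thesis
        unfolding G_def pw_add[of "L - 2 * (k + 1) - s + 1"] 
        by (simp only: C2 C3 Q3 A_def[symmetric] B_def[symmetric] z_def[symmetric] diff_add_cancel)
    qed
    have "(1 - p * z * x * (p * y)) * (Q * x * A * (B * (1 - p * y)) * C - Q * x * x * A * B * (C * (1 - p * (p * z))))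
        - p * (p * z) * x * x * (Q * A * (B * (1 - p * y) * (1 - y)) * C)
       = (p * (p * z) * (Q * x) * (A * (1 - x)) * (B * (1 - p * y)) * C
       + Q * x * (A * (1 - x)) * (B * (1 - p * y)) * (C * (1 - p * (p * z)))
       - p * z * (p * y) * (Q * x * x) * (A * (1 - x)) * B * (C * (1 - p * (p * z))))
       - (z * (Q * x * x * (p * y)) * A * B * (C * (1 - p * (p * z)) * (1 - p * z))
        + Q * x * x * (p * y) * A * B * (C * (1 - p * (p * z)) * (1 - p * z) * (1 - z)))"
      by (simp add: algebra_simps)
    then show ?thesis
      unfolding t1 t2 t3 PL PLs g1 g2[symmetric] by (simp add: algebra_simps)
  qed
  then have "(\<Sum>k = 0..K. (1 - p powi L) * (tsum_term p L (s - 1) k - tsum_term p L s k)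
     - (p powi (L - s + 1) * tsum_term p (L - 1) (s - 2) k - p powi (L + s) * tsum_term p (L - 1) (s + 1) k)) = 0"
    by (simp only:) (rule sum_int_telescope, auto simp: G_def K_def intro!: tsum_term_eq_0)
  moreover have "(\<Sum>k = 0..K. (1 - p powi L) * (tsum_term p L (s - 1) k - tsum_term p L s k)
     - (p powi (L - s + 1) * tsum_term p (L - 1) (s - 2) k - p powi (L + s) * tsum_term p (L - 1) (s + 1) k))
    = (1 - p powi L) * (tsum p L (s - 1) - tsum p L s)
      - (p powi (L - s + 1) * tsum p (L - 1) (s - 2) - p powi (L + s) * tsum p (L - 1) (s + 1))"
  proof -
    have "tsum p L t = (\<Sum>k = 0..K. tsum_term p L t k)" "tsum p (L - 1) t = (\<Sum>k = 0..K. tsum_term p (L - 1) t k)" for t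
      by (intro tsum_eq_sum; simp add: K_def)+
    then show ?thesis by (simp only: sum_subtractf flip: sum_distrib_left)
  qed
  ultimately show ?thesis by simp
qed

text \<open>With \<open>i = k + a + u\<close>, where \<open>k\<close> is the summation index of
  \<open>tsum\<close>, the sum over \<open>u\<close> is a q-Vandermonde sum. In the resulting
  product of two Gaussian coefficients the factor (p; p)_c cancels, with c + (k + a) = L.\<close>

lemma dual_sum_right_0:
  assumes "a \<ge> 0"
  shows "dual_sum p L a 0 = p powi tri (a - 1) * qpoch p (nat L) * tsum p L a"
proof (cases "L < 0")
  case True
  then show ?thesis by (simp add: dual_sum_def tsum_eq_0)
next
  case False
  define f where "f i u = p powi tri (i - 1) * rtri_term p i (L - i) a 0 u" for i u
  have "dual_sum p L a 0 = (\<Sum>i = 0..L. \<Sum>u = 0..L. f i u)"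
    unfolding dual_sum_def f_def sum_distrib_left[symmetric]
    by (intro sum.cong refl arg_cong2[where f = "(*)"] rtri_eq_sum) (use assms in auto)
  also have "\<dots> = (\<Sum>u = 0..L. \<Sum>i = 0..L. f i u)"
    by (rule sum.swap)
  also have "\<dots> = (\<Sum>u = 0..L. \<Sum>k = 0..L. f (k + a + u) u)"
  proof (rule sum.cong[OF refl])
    fix u assume u: "u \<in> {0..L}"
    have out: "f i u = 0" if "i < 0 \<or> i > L \<or> i - a - u < 0 \<or> i - a - u > L" for i
    proof -
      have "2 * u > i - a \<or> L - i < 0" using that u assms by auto
      then show ?thesis by (auto simp: f_def rtri_term_eq_0)
    qed
    show "(\<Sum>i = 0..L. f i u) = (\<Sum>k = 0..L. f (k + a + u) u)"
      by (rule sum.reindex_bij_witness_not_neutral[where i = "\<lambda>k. k + a + u" and j = "\<lambda>i. i - a - u"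
        and S' = "{0..L} - {a + u..L + a + u}" and T' = "{0..L} - {- a - u..L - a - u}"])
       (auto intro!: out)
  qed
  also have "\<dots> = (\<Sum>k = 0..L. \<Sum>u = 0..L. f (k + a + u) u)"
    by (rule sum.swap)
  also have "\<dots> = (\<Sum>k = 0..L. p powi tri (a - 1) * qpoch p (nat L) * tsum_term p L a k)"
  proof (rule sum.cong[OF refl])
    fix k assume k: "k \<in> {0..L}"
    define c where "c = L - a - k"
    have e: "tri (k + a + u - 1) + (tri (k - u) + u) = tri (a - 1) + k * (k + a) + u * (u + a)" for u
    proof -
      have "2 * (tri (k + a + u - 1) + (tri (k - u) + u)) = 2 * (tri (a - 1) + k * (k + a) + u * (u + a))"
        unfolding distrib_left two_tri by (simp add: algebra_simps)
      then show ?thesis by simp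
    qed
    have f: "f (k + a + u) u = p powi (tri (a - 1) + k * (k + a)) * qbin p k (c - k)
        * (p powi (u * (u + a)) * qbin p u (k - u) * qbin p (c - u) (a + u))" for u
    proof -
      have n: "k + a + u - a - 2 * u = k - u" "L - (k + a + u) = c - u" "c - u - (k - u) = c - k" by (auto simp: c_def)
      have "f (k + a + u) u = p powi (tri (k + a + u - 1) + (tri (k - u) + u)) * (qbin p (k - u) (c - k) * qbin p (c - u) u) * qbin p (c - u) (u + a)"
        unfolding f_def rtri_term_def n pw_add[of "tri (k + a + u - 1)"] using n by simp
      also have "qbin p (k - u) (c - k) * qbin p (c - u) u = qbin p (k - u) u * qbin p k (c - k)"
        using qbin_mult_commute[of "k - u" "c - k" u] by simp
      finally show ?thesis unfolding e pw_add using qbin_commute[of p u "k - u"] by (simp add: ac_simps)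
    qed
    have "(\<Sum>u = 0..L. f (k + a + u) u) = p powi (tri (a - 1) + k * (k + a)) * qbin p k (c - k) * qbin p c (k + a)"
      using q_vandermonde[of a c L "nat k"] k assms unfolding f sum_distrib_left[symmetric] by (simp add: c_def)
    also have "\<dots> = p powi tri (a - 1) * qpoch p (nat L) * tsum_term p L a k"
    proof (cases "c \<ge> k")
      case True
      have n: "L - 2 * k - a = c - k" "L = c + (k + a)" by (auto simp: c_def)
      obtain i j l where ijl: "k = int i" "c = int j" "a = int l" using k True assms
        by (metis atLeastAtMost_iff nonneg_int_cases order_trans)
      then have ij: "i \<le> j" "c - k = int (j - i)" "k + a = int (i + l)" using True by auto
      have Lj: "nat L = j + (i + l)" using n(2) ijl by simp
      have "qbin p k (c - k) * qbin p c (k + a) = qpoch p (nat L) * (inv_qpoch p k * inv_qpoch p (k + a) * inv_qpoch p (c - k))"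
        unfolding Lj ij(2,3) unfolding ijl qbin_of_nat using ij(1)
          by (simp add: inv_qpoch_def del: of_nat_add of_nat_diff)
      then show ?thesis unfolding tsum_term_def n(1) pw_add by (simp add: ac_simps)
    next
      case False
      then show ?thesis by (simp add: tsum_term_def c_def)
    qed
    finally show "(\<Sum>u = 0..L. f (k + a + u) u) = p powi tri (a - 1) * qpoch p (nat L) * tsum_term p L a k" .
  qed
  also have "\<dots> = p powi tri (a - 1) * qpoch p (nat L) * tsum p L a"
    by (simp add: tsum_eq_sum[of L L] sum_distrib_left)
  finally show ?thesis .
qed

lemma dual_sum_eq_0: "L < 0 \<or> L < a \<Longrightarrow> dual_sum p L a b = 0"
proof -
  assume *: "L < 0 \<or> L < a"
  have "rtri p i (L - i) a b = 0" if "i \<in> {0..L}" for i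
    using * that by (auto intro: rtri_eq_0)
  then show ?thesis unfolding dual_sum_def by (simp add: sum.neutral)
qed

text \<open>The coefficient p^(L-i+e) varies with \<open>i\<close>, but \<open>tri (i - 1)\<close>
  exceeds \<open>tri (i - 2)\<close> by \<open>i - 1\<close>, so a constant power comes out. This
  lets \<open>rtri_raise\<close>, taken at \<open>M = L - i\<close>, pass to the whole sum.\<close>

lemma dual_sum_shift:
  "(\<Sum>i = 0..L. p powi tri (i - 1) * (p powi (L - i + e) * rtri p (i - 1) (L - i) a b)) = p powi (L + e - 1) * dual_sum p (L - 1) a b"
proof -
  have "tri (i - 1) = tri (i - 1 - 1) + (i - 1)" for i
    by (rule tri_rec)
  then have "p powi tri (i - 1) * p powi (L - i + e) = p powi (L + e - 1) * p powi tri (i - 1 - 1)" for i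
    unfolding pw_add[symmetric] by (intro arg_cong[of _ _ "\<lambda>e. p powi e"]) (simp add: algebra_simps)
  then have "(\<Sum>i = 0..L. p powi tri (i - 1) * (p powi (L - i + e) * rtri p (i - 1) (L - i) a b))
     = (\<Sum>i = 0..L. p powi (L + e - 1) * (p powi tri (i - 1 - 1) * rtri p (i - 1) (L - 1 - (i - 1)) a b))"
    by (simp flip: mult.assoc)
  also have "\<dots> = (\<Sum>i = 0..L. p powi (L + e - 1) * (p powi tri (i - 1) * rtri p i (L - 1 - i) a b))"
    by (rule sum_int_shift) (simp_all add: rtri_eq_0)
  also have "\<dots> = p powi (L + e - 1) * (\<Sum>i = 0..L. p powi tri (i - 1) * rtri p i (L - 1 - i) a b)"
    by (simp add: sum_distrib_left)
  also have "(\<Sum>i = 0..L. p powi tri (i - 1) * rtri p i (L - 1 - i) a b) = dual_sum p (L - 1) a b"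
    unfolding dual_sum_def by (rule sum.mono_neutral_right) (auto simp: rtri_eq_0)
  finally show ?thesis .
qed

lemma dual_sum_raise:
  assumes "a \<ge> 1" "b \<ge> 1"
  shows "dual_sum p L a (b - 1) - p powi (L - b) * dual_sum p (L - 1) (a - 1) (b - 1)
    = dual_sum p L a b - p powi (L + b) * dual_sum p (L - 1) (a + 1) b"
proof -
  have "dual_sum p L a (b - 1) - p powi (L - b) * dual_sum p (L - 1) (a - 1) (b - 1)
     = (\<Sum>i = 0..L. p powi tri (i - 1) * (rtri p i (L - i) a (b - 1) - p powi (L - i + (1 - b)) * rtri p (i - 1) (L - i) (a - 1) (b - 1)))"
    using dual_sum_shift[of L "1 - b" "a - 1" "b - 1"] by (simp add: dual_sum_def sum_subtractf right_diff_distrib)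
  also have "\<dots> = (\<Sum>i = 0..L. p powi tri (i - 1) * (rtri p i (L - i) a b - p powi (L - i + (b + 1)) * rtri p (i - 1) (L - i) (a + 1) b))"
  proof (intro sum.cong refl arg_cong2[where f = "(*)"])
    fix i
    have "L - i + (1 - b) = L - i - b + 1" "L - i + (b + 1) = L - i + b + 1" by auto
    then show "rtri p i (L - i) a (b - 1) - p powi (L - i + (1 - b)) * rtri p (i - 1) (L - i) (a - 1) (b - 1)
      = rtri p i (L - i) a b - p powi (L - i + (b + 1)) * rtri p (i - 1) (L - i) (a + 1) b"
      using rtri_raise[OF assms, of i "L - i"] by (simp only:)
  qed
  also have "\<dots> = dual_sum p L a b - p powi (L + b) * dual_sum p (L - 1) (a + 1) b"
    using dual_sum_shift[of L "b + 1" "a + 1" "b"] by (simp add: dual_sum_def sum_subtractf right_diff_distrib)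
  finally show ?thesis .
qed

text \<open>Same scheme as the Burge transformation, but \<open>M\<close> is tied to
  \<open>L\<close>, so one inner induction on \<open>L\<close> suffices. The factor
  \<open>1 - p powi L\<close> in \<open>tsum_raise\<close> is the quotient of the q-factorials at
  \<open>L\<close> and \<open>L - 1\<close>.\<close>

lemma dual_transform_nonneg:
  assumes "0 \<le> b" "b \<le> a"
  shows "dual_sum p L a b = p powi tri (a - 1) * qpoch p (nat L) * tsum p L (a + b)"
  using assms
proof (induction b arbitrary: a L rule: int_ge_induct)
  case base
  then show ?case using dual_sum_right_0[of a L] by simp
next
  case (step b)
  note IH = step.IH
  define B where "B = b + 1"
  have B: "B \<ge> 1" "b = B - 1" using step.hyps by (auto simp: B_def)
  have "dual_sum p L a B = p powi tri (a - 1) * qpoch p (nat L) * tsum p L (a + B)" if "L < int l" "a \<ge> B" for l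
    using that
  proof (induction l arbitrary: L a)
    case 0
    then show ?case by (simp add: dual_sum_eq_0 tsum_eq_0)
  next
    case (Suc l)
    show ?case
    proof (cases "L \<le> 0")
      case True
      then have "L < a" using Suc.prems B by simp
      then show ?thesis using B by (simp add: dual_sum_eq_0 tsum_eq_0)
    next
      case False
      define P where "P = qpoch p (nat (L - 1))"
      have P: "qpoch p (nat L) = P * (1 - p powi L)"
      proof -
        obtain n where "L = int (Suc n)" using False by (metis not_le zero_less_imp_eq_int gr0_implies_Suc)
        then show ?thesis unfolding P_def by (simp add: qpoch_Suc power_int_def nat_add_distrib)
      qed
      have A2: "dual_sum p (L - 1) (a + 1) B = p powi tri a * P * tsum p (L - 1) (a + B + 1)"
        using Suc.IH[of "L - 1" "a + 1"] Suc.prems by (simp add: P_def algebra_simps)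
      have A3: "dual_sum p L a (B - 1) = p powi tri (a - 1) * qpoch p (nat L) * tsum p L (a + B - 1)"
        using IH[of a L] Suc.prems B by (simp add: algebra_simps)
      have A4: "dual_sum p (L - 1) (a - 1) (B - 1) = p powi tri (a - 2) * P * tsum p (L - 1) (a + B - 2)"
        using IH[of "a - 1" "L - 1"] Suc.prems B by (simp add: P_def algebra_simps)
      have t1: "p powi (L + B) * p powi tri a = p powi tri (a - 1) * p powi (L + (a + B))"
        unfolding pw_add[symmetric] by (rule arg_cong[of _ _ "\<lambda>e. p powi e"]) (use tri_rec[of a] in linarith)
      have "a - 1 - 1 = a - 2" by simp
      then have t2: "p powi (L - B) * p powi tri (a - 2) = p powi tri (a - 1) * p powi (L - (a + B) + 1)"
        unfolding pw_add[symmetric] using tri_rec[of "a - 1"] by (intro arg_cong[of _ _ "\<lambda>e. p powi e"]) simp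
      have "dual_sum p L a B = p powi tri (a - 1) * qpoch p (nat L) * tsum p L (a + B - 1)
         - (p powi (L - B) * p powi tri (a - 2)) * P * tsum p (L - 1) (a + B - 2)
         + (p powi (L + B) * p powi tri a) * P * tsum p (L - 1) (a + B + 1)"
        using dual_sum_raise[of a B L] Suc.prems B unfolding A2 A3 A4 by (simp add: algebra_simps)
      also have "\<dots> = p powi tri (a - 1) * P * ((1 - p powi L) * tsum p L (a + B - 1)
         - (p powi (L - (a + B) + 1) * tsum p (L - 1) (a + B - 2)
         - p powi (L + (a + B)) * tsum p (L - 1) (a + B + 1)))"
        unfolding t1 t2 P by (simp add: algebra_simps)
      also have "\<dots> = p powi tri (a - 1) * P * ((1 - p powi L) * tsum p L (a + B))"
        unfolding tsum_raise[symmetric] by (simp add: algebra_simps)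
      finally show ?thesis unfolding P by (simp add: mult.assoc)
    qed
  qed
  from this[of "nat (L + 1)"] step.prems show ?case by (simp add: B_def)
qed

end

text \<open>The two maps need to be inverse to each other only where the summands are nonzero, so
  the index ranges can be chosen generously.\<close>

lemma sum_reindex_support:
  fixes f :: "'b \<Rightarrow> 'a::comm_monoid_add" and g :: "'c \<Rightarrow> 'a"
  assumes "finite S" "finite T"
    and "\<And>x. x \<in> S \<Longrightarrow> f x \<noteq> 0 \<Longrightarrow> j x \<in> T \<and> i (j x) = x \<and> g (j x) = f x"
    and "\<And>y. y \<in> T \<Longrightarrow> g y \<noteq> 0 \<Longrightarrow> i y \<in> S \<and> j (i y) = y \<and> f (i y) = g y"
  shows "sum f S = sum g T"
proof -
  have "sum f S = sum f {x \<in> S. f x \<noteq> 0}"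
    using assms(1) by (intro sum.mono_neutral_right) auto
  also have "\<dots> = sum g {y \<in> T. g y \<noteq> 0}"
    by (rule sum.reindex_bij_witness[where i = i and j = j]) (auto simp: assms(3,4))
  also have "\<dots> = sum g T"
    using assms(2) by (intro sum.mono_neutral_left) auto
  finally show ?thesis .
qed

section \<open>Negative indices by reflection\<close>

context nonroot begin

text \<open>Replacing \<open>u\<close> by \<open>u + a\<close> swaps the roles of the two
  coefficients with tops \<open>M + b\<close> and \<open>M - b\<close>. The trinomial itself is
  invariant; the factor \<open>p powi a\<close> is the ratio of the normalisations p^((L+a)/2) and
  p^((L-a)/2).\<close>

lemma rtri_uminus: "rtri p L M (- a) (- b) = p powi a * rtri p L M a b"
proof -
  define K where "K = \<bar>L\<bar> + \<bar>a\<bar>"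
  have shift: "rtri_term p L M (- a) (- b) (u + a) = p powi a * rtri_term p L M a b u" for u
  proof -
    have e: "L - - a - 2 * (u + a) = L - a - 2 * u" "u + a + - a = u" "M + - b = M - b" "M - - b = M + b" by auto
    have "p powi (tri (L - a - 2 * u) + (u + a)) = p powi a * p powi (tri (L - a - 2 * u) + u)"
      unfolding pw_add[symmetric] by (simp add: algebra_simps)
    then show ?thesis unfolding rtri_term_def e by (simp only: mult_ac)
  qed
  have K: "rtri p L M (- a) (- b) = (\<Sum>u = 0..K. rtri_term p L M (- a) (- b) u)"
    "rtri p L M a b = (\<Sum>u = 0..K. rtri_term p L M a b u)"
    by (intro rtri_eq_sum; simp add: K_def)+
  have "(\<Sum>u = 0..K. rtri_term p L M a b u * p powi a) = (\<Sum>u = 0..K. rtri_term p L M (- a) (- b) u)"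
  proof (rule sum_reindex_support[where i = "\<lambda>u. u - a" and j = "\<lambda>u. u + a"])
    fix u assume "u \<in> {0..K}" and nz: "rtri_term p L M a b u * p powi a \<noteq> 0"
    from nz have "rtri_term p L M a b u \<noteq> 0" by auto
    then have "\<not> u < 0" "\<not> 2 * u > L - a" "\<not> u + a < 0"
      by (metis rtri_term_eq_0(1), metis rtri_term_eq_0(2), metis rtri_term_eq_0(4))
    then show "u + a \<in> {0..K} \<and> u + a - a = u \<and> rtri_term p L M (- a) (- b) (u + a) = rtri_term p L M a b u * p powi a"
      by (auto simp: K_def shift mult.commute)
  next
    fix u assume "u \<in> {0..K}" and nz: "rtri_term p L M (- a) (- b) u \<noteq> 0"
    then have "\<not> u < 0" "\<not> 2 * u > L - (- a)" "\<not> u + (- a) < 0"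
      by (metis rtri_term_eq_0(1), metis rtri_term_eq_0(2), metis rtri_term_eq_0(4))
    then show "u - a \<in> {0..K} \<and> u - a + a = u \<and> rtri_term p L M a b (u - a) * p powi a = rtri_term p L M (- a) (- b) u"
      using shift[of "u - a"] by (auto simp: K_def mult.commute)
  qed auto
  then show ?thesis unfolding K by (simp add: sum_distrib_left mult.commute)
qed

lemma tsum_uminus: "tsum p L (- s) = tsum p L s"
  unfolding tsum_def
proof (rule sum_reindex_support[where i = "\<lambda>k. k + s" and j = "\<lambda>k. k - s"])
  have shift: "tsum_term p L (- s) (k + s) = tsum_term p L s k" for k
    unfolding tsum_term_def by (simp add: algebra_simps)
  fix k
  show "k - s \<in> {0..\<bar>L\<bar>} \<and> k - s + s = k \<and> tsum_term p L s (k - s) = tsum_term p L (- s) k"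
    if "tsum_term p L (- s) k \<noteq> 0"
  proof -
    have "\<not> (k < 0 \<or> k > L \<or> k + (- s) < 0 \<or> 2 * k + (- s) > L)"
      using that tsum_term_eq_0 by blast
    then show ?thesis using shift[of "k - s"] by auto
  qed
  show "k + s \<in> {0..\<bar>L\<bar>} \<and> k + s - s = k \<and> tsum_term p L (- s) (k + s) = tsum_term p L s k"
    if "tsum_term p L s k \<noteq> 0"
  proof -
    have "\<not> (k < 0 \<or> k > L \<or> k + s < 0 \<or> 2 * k + s > L)"
      using that tsum_term_eq_0 by blast
    then show ?thesis using shift[of k] by auto
  qed
qed auto

text \<open>For \<open>k \<ge> 1\<close> the numbers \<open>k * j\<close> and \<open>j\<close> do
  not differ in sign and |j| \<le> |k j|, so for negative \<open>j\<close> reflection leads back to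
  the nonnegative case. The powers from \<open>rtri_uminus\<close> account for the difference
  between \<open>tri l\<close> and \<open>tri (- l)\<close>.\<close>

lemma burge_transform:
  assumes "k \<ge> 1"
  shows "burge_sum p L M (k * j) j = p powi tri j * rtri p L M ((k + 1) * j) j"
proof (cases "j \<ge> 0")
  case True
  then show ?thesis
    using burge_transform_nonneg[of j "k * j" L M] assms mult_right_mono[of 1 k j] by (simp add: algebra_simps)
next
  case False
  define l where "l = - j"
  have l: "l \<ge> 0" "l \<le> k * l" using False assms mult_right_mono[of 1 k l] by (auto simp: l_def)
  have "burge_sum p L M (- (k * l)) (- l) = p powi (k * l) * burge_sum p L M (k * l) l"
    unfolding burge_sum_def rtri_uminus by (simp add: sum_distrib_left mult_ac)
  also have "\<dots> = p powi (k * l) * (p powi tri l * rtri p L M (k * l + l) l)"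
    using burge_transform_nonneg[OF l] by simp
  also have "p powi (k * l) * (p powi tri l * rtri p L M (k * l + l) l)
      = p powi tri (- l) * (p powi (k * l + l) * rtri p L M (k * l + l) l)"
  proof -
    have "2 * (k * l + tri l) = 2 * (tri (- l) + (k * l + l))"
      unfolding distrib_left two_tri by (simp add: algebra_simps)
    then have "k * l + tri l = tri (- l) + (k * l + l)" by simp
    then show ?thesis unfolding mult.assoc[symmetric] pw_add[symmetric] by (simp only:)
  qed
  also have "p powi (k * l + l) * rtri p L M (k * l + l) l = rtri p L M (- (k * l + l)) (- l)"
    by (rule rtri_uminus[symmetric])
  finally show ?thesis unfolding l_def by (simp add: algebra_simps)
qed

lemma dual_transform:
  assumes "k \<ge> 1"
  shows "dual_sum p L (k * j) j = p powi tri (k * j - 1) * qpoch p (nat L) * tsum p L ((k + 1) * j)"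
proof (cases "j \<ge> 0")
  case True
  then show ?thesis
    using dual_transform_nonneg[of j "k * j" L] assms mult_right_mono[of 1 k j] by (simp add: algebra_simps)
next
  case False
  define l where "l = - j"
  have l: "l \<ge> 0" "l \<le> k * l" using False assms mult_right_mono[of 1 k l] by (auto simp: l_def)
  have "dual_sum p L (- (k * l)) (- l) = p powi (k * l) * dual_sum p L (k * l) l"
    unfolding dual_sum_def rtri_uminus by (simp add: sum_distrib_left mult_ac)
  also have "\<dots> = p powi (k * l) * p powi tri (k * l - 1) * qpoch p (nat L) * tsum p L (- (k * l + l))"
    unfolding tsum_uminus using dual_transform_nonneg[OF l] by (simp only: mult.assoc)
  also have "p powi (k * l) * p powi tri (k * l - 1) = p powi tri (- (k * l) - 1)"
  proof -
    have "2 * (k * l + tri (k * l - 1)) = 2 * tri (- (k * l) - 1)"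
      unfolding distrib_left two_tri by (simp add: algebra_simps)
    then have "k * l + tri (k * l - 1) = tri (- (k * l) - 1)" by simp
    then show ?thesis unfolding pw_add[symmetric] by (simp only:)
  qed
  finally show ?thesis unfolding l_def by (simp add: algebra_simps)
qed

lemma qtrinom2_eq_tsum: "qtrinom2 p L s s = qpoch p L * tsum p (int L) s"
proof -
  define f where "f n = p powi (int n * (int n + s)) *
        (qpoch p L * inv_qpoch p (int n) * inv_qpoch p (int n + s) * inv_qpoch p (int L - 2 * int n - s))" for n
  have f: "f n = qpoch p L * tsum_term p L s (int n)" for n
    unfolding f_def tsum_term_def by (simp add: mult_ac)
  have "qtrinom2 p L s s = sum' f UNIV"
    unfolding qtrinom2_def f_def ..
  also have "\<dots> = sum' f {..L}"
    by (rule sum.mono_neutral_right') (auto simp: f intro!: tsum_term_eq_0)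
  also have "\<dots> = sum f {..L}"
    by (rule sum.eq_sum) simp
  also have "\<dots> = (\<Sum>k = 0..int L. qpoch p L * tsum_term p L s k)"
    by (rule sum.reindex_bij_witness[where i = nat and j = int]) (auto simp: f)
  also have "\<dots> = qpoch p L * tsum p (int L) s"
    by (simp add: tsum_def sum_distrib_left)
  finally show ?thesis .
qed

end

section \<open>The cubic seed identity\<close>

lemma sum_atMost_int: "(\<Sum>i\<le>n. f (int i)) = (\<Sum>i = 0..int n. f i)"
  by (rule sum.reindex_bij_witness[where i = nat and j = int]) auto

text \<open>The finite q-binomial theorem; \<open>tri (int m - 1)\<close> is m (m - 1)/2. The free
  factor \<open>c\<close> accommodates the residue classes modulo 3.\<close>

lemma (in nonroot) coeff_qprod:
  "poly.coeff (\<Prod>k<N. [:1, c * p ^ k:]) m = c ^ m * p powi tri (int m - 1) * qbin p (int m) (int N - int m)"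
proof (induction N arbitrary: m)
  case 0
  then show ?case by (cases m) (auto simp: qbin_0_left tri_def)
next
  case (Suc N)
  show ?case
  proof (cases m)
    case 0
    then show ?thesis by (simp add: Suc coeff_mult qbin_0_left tri_def)
  next
    case (Suc l)
    have "poly.coeff (\<Prod>k<Suc N. [:1, c * p ^ k:]) m
      = poly.coeff (\<Prod>k<N. [:1, c * p ^ k:]) m + c * p ^ N * poly.coeff (\<Prod>k<N. [:1, c * p ^ k:]) l"
      by (simp add: Suc mult_pCons_right)
    also have "\<dots> = c ^ m * p powi tri (int m - 1) * qbin p (int m) (int N - int m)
       + c ^ m * (p powi int N * p powi tri (int m - 2)) * qbin p (int m - 1) (int (Suc N) - int m)"
      unfolding Suc.IH by (simp add: Suc algebra_simps)
    also have "p powi int N * p powi tri (int m - 2) = p powi tri (int m - 1) * p powi (int (Suc N) - int m)"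
    proof -
      have "int m - 1 - 1 = int m - 2" by simp
      then show ?thesis
        unfolding pw_add[symmetric] using tri_rec[of "int m - 1"]
        by (intro arg_cong[of _ _ "\<lambda>e. p powi e"]) simp
    qed
    also have "c ^ m * p powi tri (int m - 1) * qbin p (int m) (int N - int m)
        + c ^ m * (p powi tri (int m - 1) * p powi (int (Suc N) - int m)) * qbin p (int m - 1) (int (Suc N) - int m)
      = c ^ m * p powi tri (int m - 1) * qbin p (int m) (int (Suc N) - int m)"
      using qbin_pascal'[of "int m" "int (Suc N) - int m"] Suc by (simp add: algebra_simps)
    finally show ?thesis .
  qed
qed

lemma (in nonroot) nonroot_cube: "nonroot (p ^ 3)"
  by standard (use p0 nonroot in \<open>auto simp flip: power_mult\<close>)

locale nonroot_cube = q: nonroot q for q :: "'a::field"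

sublocale nonroot_cube \<subseteq> p: nonroot "q ^ 3"
  by (rule q.nonroot_cube)

context nonroot_cube begin

lemma pq: "(q ^ 3) powi n = q powi (3 * n)"
  by (metis power_int_mult power_int_numeral)

lemma prod_split_mod_3:
  fixes c :: 'a
  shows "(\<Prod>k<3 * M. [:1, c * q ^ k:])
    = (\<Prod>k<M. [:1, c * (q ^ 3) ^ k:]) * ((\<Prod>k<M. [:1, c * q\<^sup>2 * (q ^ 3) ^ k:]) * (\<Prod>k<M. [:1, c * q * (q ^ 3) ^ k:]))"
proof (induction M)
  case (Suc M)
  have "3 * Suc M = Suc (Suc (Suc (3 * M)))" by simp
  then have "(\<Prod>k<3 * Suc M. [:1, c * q ^ k:]) = (\<Prod>k<3 * M. [:1, c * q ^ k:])
      * [:1, c * q ^ (3 * M):] * [:1, c * q ^ Suc (3 * M):] * [:1, c * q ^ Suc (Suc (3 * M)):]"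
    by (simp only: prod.lessThan_Suc)
  moreover have "c * q ^ (3 * M) = c * (q ^ 3) ^ M" "c * q ^ Suc (3 * M) = c * q * (q ^ 3) ^ M"
    "c * q ^ Suc (Suc (3 * M)) = c * q\<^sup>2 * (q ^ 3) ^ M"
    by (simp_all add: power_mult power2_eq_square)
  ultimately show ?case unfolding Suc.IH by (simp only: prod.lessThan_Suc mult_ac)
qed simp

text \<open>Comparison of coefficients in \<open>prod_split_mod_3\<close> with
  \<open>c = q\<^sup>2\<close>. This offset starts the three classes at q^2, q^4 and q^3, which
  gives the exponents \<open>3 * tri s - s\<close>, \<open>3 * tri s' + s'\<close> and an
  unperturbed \<open>3 * tri\<close>; the first two classes are later paired by Saalschuetz.\<close>

lemma qbin_split_mod_3:
  assumes "m \<le> K"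
  shows "q powi (tri (m - 1) + 2 * m) * qbin q m (3 * int M - m)
    = (\<Sum>s = 0..K. \<Sum>s' = 0..K. q powi (3 * tri s - s) * qbin (q ^ 3) s (int M - s)
        * (q powi (3 * tri s' + s') * qbin (q ^ 3) s' (int M - s'))
        * (q powi (3 * tri (m - s - s')) * qbin (q ^ 3) (m - s - s') (int M - (m - s - s'))))"
    (is "_ = (\<Sum>s = 0..K. \<Sum>s' = 0..K. ?a s * ?c s' * ?b (m - s - s'))")
proof (cases "m < 0")
  case True
  then have "?b (m - s - s') = 0" if "s \<in> {0..K}" "s' \<in> {0..K}" for s s'
    using that by simp
  then show ?thesis using True by (simp add: sum.neutral)
next
  case False
  then obtain l where l: "m = int l" by (metis nonneg_int_cases not_less)
  have co: "poly.coeff (\<Prod>k<M. [:1, q\<^sup>2 * (q ^ 3) ^ k:]) i = ?a (int i)"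
    "poly.coeff (\<Prod>k<M. [:1, q\<^sup>2 * q\<^sup>2 * (q ^ 3) ^ k:]) i = ?c (int i)"
    "poly.coeff (\<Prod>k<M. [:1, q\<^sup>2 * q * (q ^ 3) ^ k:]) i = ?b (int i)" for i
  proof -
    have t: "tri (int i) = tri (int i - 1) + int i" by (rule tri_rec)
    have c: "(q ^ n) ^ i = q powi (int n * int i)" for n
      by (simp flip: power_mult of_nat_mult)
    have "q\<^sup>2 = q ^ 2" "q\<^sup>2 * q\<^sup>2 = q ^ 4" "q\<^sup>2 * q = q ^ 3" by (simp_all add: power2_eq_square power_numeral_reduce mult_ac)
    then show "poly.coeff (\<Prod>k<M. [:1, q\<^sup>2 * (q ^ 3) ^ k:]) i = ?a (int i)"
      "poly.coeff (\<Prod>k<M. [:1, q\<^sup>2 * q\<^sup>2 * (q ^ 3) ^ k:]) i = ?c (int i)"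
      "poly.coeff (\<Prod>k<M. [:1, q\<^sup>2 * q * (q ^ 3) ^ k:]) i = ?b (int i)"
      unfolding p.coeff_qprod pq t by (simp_all add: c q.pw_add[symmetric] algebra_simps)
  qed
  have "q powi (tri (m - 1) + 2 * m) * qbin q m (3 * int M - m) = poly.coeff (\<Prod>k<3 * M. [:1, q\<^sup>2 * q ^ k:]) l"
  proof -
    have "(q\<^sup>2) ^ l = q powi (2 * int l)"
      by (metis power_mult power_int_of_nat of_nat_mult of_nat_numeral)
    then show ?thesis unfolding q.coeff_qprod l q.pw_add by simp
  qed
  also have "\<dots> = (\<Sum>i\<le>l. ?a (int i) * (\<Sum>k\<le>l - i. ?c (int k) * ?b (int (l - i - k))))"
    unfolding prod_split_mod_3 coeff_mult co ..
  also have "\<dots> = (\<Sum>i\<le>l. ?a (int i) * (\<Sum>s' = 0..K. ?c s' * ?b (m - int i - s')))"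
  proof (intro sum.cong refl arg_cong2[where f = "(*)"])
    fix i assume "i \<in> {..l}"
    then have i: "i \<le> l" by simp
    have "(\<Sum>k\<le>l - i. ?c (int k) * ?b (int (l - i - k))) = (\<Sum>k\<le>l - i. ?c (int k) * ?b (m - int i - int k))"
      using i by (intro sum.cong refl) (simp add: l of_nat_diff algebra_simps)
    also have "\<dots> = (\<Sum>s' = 0..int (l - i). ?c s' * ?b (m - int i - s'))"
      by (rule sum_atMost_int)
    also have "\<dots> = (\<Sum>s' = 0..K. ?c s' * ?b (m - int i - s'))"
      by (rule sum.mono_neutral_left) (use i assms l in \<open>auto simp: of_nat_diff\<close>)
    finally show "(\<Sum>k\<le>l - i. ?c (int k) * ?b (int (l - i - k))) = (\<Sum>s' = 0..K. ?c s' * ?b (m - int i - s'))" .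
  qed
  also have "\<dots> = (\<Sum>s = 0..int l. ?a s * (\<Sum>s' = 0..K. ?c s' * ?b (m - s - s')))"
    by (rule sum_atMost_int)
  also have "\<dots> = (\<Sum>s = 0..K. ?a s * (\<Sum>s' = 0..K. ?c s' * ?b (m - s - s')))"
  proof (rule sum.mono_neutral_left)
    have "?b (m - s - s') = 0" if "s > m" "s' \<ge> 0" for s s' using that by simp
    then show "\<forall>s\<in>{0..K} - {0..int l}. ?a s * (\<Sum>s' = 0..K. ?c s' * ?b (m - s - s')) = 0"
      by (auto simp: l intro!: sum.neutral)
  qed (use assms l in auto)
  also have "\<dots> = (\<Sum>s = 0..K. \<Sum>s' = 0..K. ?a s * ?c s' * ?b (m - s - s'))"
    by (simp add: sum_distrib_left mult.assoc)
  finally show ?thesis .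
qed

text \<open>The sum over \<open>m\<close> from the multisum, with m = L - 2 t so that parity is
  built in. It is scaled by q^(3 L/2): the exponent equals m^2/2 + 3 L/2.\<close>

definition seed :: "int \<Rightarrow> int \<Rightarrow> 'a" where
  "seed L M = (\<Sum>t = 0..L. q powi (tri (L - 2 * t - 1) + 2 * (L - 2 * t) + 3 * t)
     * qbin q (L - 2 * t) (3 * M - (L - 2 * t)) * qbin (q ^ 3) (2 * M) t)"

text \<open>The Saalschuetz sum splits the two Gaussian coefficients in \<open>rtri (q ^ 3) L M j j\<close>; with the third one
  they are the residue classes of the q-binomial theorem modulo 3.\<close>

lemma seed_eq_rtri:
  assumes "M \<ge> 0" "L \<le> J"
  shows "seed L M = (\<Sum>j = -J..J. q powi (3 * tri j + j) * rtri (q ^ 3) L M j j)"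
proof -
  define E where "E s = qbin (q ^ 3) s (M - s)" for s
  \<comment> \<open>The two families correspond under \<open>j = s' - s\<close>,
    \<open>u = s + t\<close>. Then \<open>L - j - 2 * u\<close> is the index of the third residue
    class, and \<open>(u - t) * (u + j - t)\<close> is \<open>s * s'\<close>, the cross term
    required by Saalschuetz.\<close>
  define f where "f = (\<lambda>(t, s, s'). q powi (3 * t) * qbin (q ^ 3) (2 * M) t * (q powi (3 * tri s - s) * E s
        * (q powi (3 * tri s' + s') * E s') * (q powi (3 * tri (L - 2 * t - s - s')) * E (L - 2 * t - s - s'))))"
  define g where "g = (\<lambda>(j, u, t). q powi (3 * tri j + j) * (q powi (3 * (tri (L - j - 2 * u) + u)) * E (L - j - 2 * u)
        * (q powi (3 * ((u - t) * (u + j - t))) * E (u - t) * E (u + j - t) * qbin (q ^ 3) (2 * M) t)))"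
  have M: "int (nat M) = M" using assms by simp
  have fg: "g (s' - s, s + t, t) = f (t, s, s')" for t s s'
  proof -
    have n: "L - (s' - s) - 2 * (s + t) = L - 2 * t - s - s'" "s + t - t = s" "s + t + (s' - s) - t = s'" by auto
    have "2 * (tri (s' - s) + s + s * s') = 2 * (tri s + tri s')"
      unfolding distrib_left two_tri by (simp add: algebra_simps)
    then have "tri (s' - s) + s + s * s' = tri s + tri s'" by simp
    then have e: "q powi (3 * tri (s' - s) + (s' - s)) * q powi (3 * (tri (L - 2 * t - s - s') + (s + t))) * q powi (3 * (s * s'))
       = q powi (3 * t) * q powi (3 * tri s - s) * q powi (3 * tri s' + s') * q powi (3 * tri (L - 2 * t - s - s'))"
      unfolding q.pw_add[symmetric] by (intro arg_cong[of _ _ "\<lambda>e. q powi e"]) (simp add: algebra_simps)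
    have "g (s' - s, s + t, t) = (q powi (3 * tri (s' - s) + (s' - s)) * q powi (3 * (tri (L - 2 * t - s - s') + (s + t))) * q powi (3 * (s * s')))
        * (E (L - 2 * t - s - s') * E s * E s' * qbin (q ^ 3) (2 * M) t)"
      unfolding g_def prod.case n by (simp only: mult_ac)
    also have "\<dots> = f (t, s, s')"
      unfolding f_def prod.case e by (simp only: mult_ac)
    finally show ?thesis .
  qed
  have E0: "E s = 0" if "s < 0" for s using that by (simp add: E_def)
  have "seed L M = (\<Sum>t = 0..L. \<Sum>s = 0..L. \<Sum>s' = 0..L. f (t, s, s'))"
    unfolding seed_def
  proof (rule sum.cong[OF refl])
    fix t assume t: "t \<in> {0..L}"
    have "q powi (tri (L - 2 * t - 1) + 2 * (L - 2 * t) + 3 * t) * qbin q (L - 2 * t) (3 * M - (L - 2 * t)) * qbin (q ^ 3) (2 * M) t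
       = q powi (3 * t) * qbin (q ^ 3) (2 * M) t * (q powi (tri (L - 2 * t - 1) + 2 * (L - 2 * t)) * qbin q (L - 2 * t) (3 * M - (L - 2 * t)))"
      unfolding q.pw_add[of _ "3 * t"] by (simp only: mult_ac)
    also have "\<dots> = (\<Sum>s = 0..L. \<Sum>s' = 0..L. f (t, s, s'))"
      using qbin_split_mod_3[of "L - 2 * t" L "nat M"] t unfolding M by (simp add: f_def E_def sum_distrib_left)
    finally show "q powi (tri (L - 2 * t - 1) + 2 * (L - 2 * t) + 3 * t) * qbin q (L - 2 * t) (3 * M - (L - 2 * t)) * qbin (q ^ 3) (2 * M) t
       = (\<Sum>s = 0..L. \<Sum>s' = 0..L. f (t, s, s'))" .
  qed
  also have "\<dots> = sum f ({0..L} \<times> {0..L} \<times> {0..L})"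
    by (simp add: sum.cartesian_product)
  \<comment> \<open>The bound \<open>2 * J\<close> dominates \<open>L - j\<close> for every
    \<open>j \<ge> -J\<close>, so the range of \<open>u\<close> exhausts each trinomial.\<close>
  also have "\<dots> = sum g ({-J..J} \<times> {0..2 * J} \<times> {0..2 * J})"
  proof (rule sum_reindex_support[where i = "\<lambda>(j, u, t). (t, u - t, u + j - t)" and j = "\<lambda>(t, s, s'). (s' - s, s + t, t)"])
    fix x assume x: "x \<in> {0..L} \<times> {0..L} \<times> {0..L}" "f x \<noteq> 0"
    obtain t s s' where x': "x = (t, s, s')" by (cases x)
    have "L - 2 * t - s - s' \<ge> 0" using x(2) E0 unfolding f_def x' by (auto simp: not_less[symmetric])
    then show "(case x of (t, s, s') \<Rightarrow> (s' - s, s + t, t)) \<in> {-J..J} \<times> {0..2 * J} \<times> {0..2 * J}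
      \<and> (case (case x of (t, s, s') \<Rightarrow> (s' - s, s + t, t)) of (j, u, t) \<Rightarrow> (t, u - t, u + j - t)) = x
      \<and> g (case x of (t, s, s') \<Rightarrow> (s' - s, s + t, t)) = f x"
      using x(1) assms(2) by (auto simp: x' fg)
  next
    fix y assume y: "y \<in> {-J..J} \<times> {0..2 * J} \<times> {0..2 * J}" "g y \<noteq> 0"
    obtain j u t where y': "y = (j, u, t)" by (cases y)
    have "t \<ge> 0" using y(1) y' by simp
    then have T0: "2 * t + (u - t) + (u + j - t) \<le> L \<Longrightarrow> u - t \<ge> 0 \<Longrightarrow> u + j - t \<ge> 0 \<Longrightarrow> t \<le> L \<and> u - t \<le> L \<and> u + j - t \<le> L"
      by linarith
    have "L - j - 2 * u \<ge> 0" "u - t \<ge> 0" "u + j - t \<ge> 0"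
      using y(2) E0 unfolding g_def y' by (auto simp: not_less[symmetric])
    then show "(case y of (j, u, t) \<Rightarrow> (t, u - t, u + j - t)) \<in> {0..L} \<times> {0..L} \<times> {0..L}
      \<and> (case (case y of (j, u, t) \<Rightarrow> (t, u - t, u + j - t)) of (t, s, s') \<Rightarrow> (s' - s, s + t, t)) = y
      \<and> f (case y of (j, u, t) \<Rightarrow> (t, u - t, u + j - t)) = g y"
      using y(1) fg[of "u + j - t" "u - t" t] y(2) T0 by (auto simp: y')
  qed auto
  also have "\<dots> = (\<Sum>j = -J..J. \<Sum>u = 0..2 * J. \<Sum>t = 0..2 * J. g (j, u, t))"
    by (simp add: sum.cartesian_product)
  also have "\<dots> = (\<Sum>j = -J..J. q powi (3 * tri j + j) * rtri (q ^ 3) L M j j)"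
  proof (rule sum.cong[OF refl])
    fix j assume j: "j \<in> {-J..J}"
    have g: "(\<Sum>t = 0..2 * J. g (j, u, t)) = q powi (3 * tri j + j) * rtri_term (q ^ 3) L M j j u" if "u \<in> {0..2 * J}" for u
    proof -
      have "(\<Sum>t = 0..2 * J. g (j, u, t)) = q powi (3 * tri j + j) * (q powi (3 * (tri (L - j - 2 * u) + u)) * E (L - j - 2 * u)
        * (\<Sum>t = 0..2 * J. q powi (3 * ((u - t) * (u + j - t))) * E (u - t) * E (u + j - t) * qbin (q ^ 3) (2 * M) t))"
        unfolding g_def by (simp add: sum_distrib_left)
      also have "(\<Sum>t = 0..2 * J. q powi (3 * ((u - t) * (u + j - t))) * E (u - t) * E (u + j - t) * qbin (q ^ 3) (2 * M) t)
         = qbin (q ^ 3) u (M + j) * qbin (q ^ 3) (u + j) (M - j)"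
        using p.saalschuetz[of u "2 * J" "u + j" "nat M" "nat M"] that unfolding M E_def pq
        by (simp add: algebra_simps)
      finally show ?thesis
        unfolding rtri_term_def pq E_def using qbin_commute[of "q ^ 3"] by (simp add: mult_ac)
    qed
    have "rtri (q ^ 3) L M j j = (\<Sum>u = 0..2 * J. rtri_term (q ^ 3) L M j j u)"
      using j assms by (intro rtri_eq_sum) auto
    then show "(\<Sum>u = 0..2 * J. \<Sum>t = 0..2 * J. g (j, u, t)) = q powi (3 * tri j + j) * rtri (q ^ 3) L M j j"
      by (simp add: g sum_distrib_left)
  qed
  finally show ?thesis .
qed

end

section \<open>Iteration\<close>

lemma sum'_reindex_support:
  fixes F :: "'c \<Rightarrow> 'a::comm_monoid_add" and g :: "'b \<Rightarrow> 'a"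
  assumes "finite T"
    and g: "\<And>x. x \<in> T \<Longrightarrow> g x \<noteq> 0 \<Longrightarrow> j x \<in> S \<and> i (j x) = x \<and> F (j x) = g x"
    and F: "\<And>y. y \<in> S \<Longrightarrow> F y \<noteq> 0 \<Longrightarrow> i y \<in> T \<and> j (i y) = y \<and> g (i y) = F y"
  shows "sum' F S = sum g T"
proof -
  have eq: "{y \<in> S. F y \<noteq> 0} = j ` {x \<in> T. g x \<noteq> 0}"
  proof (intro set_eqI iffI)
    fix y assume "y \<in> {y \<in> S. F y \<noteq> 0}"
    then show "y \<in> j ` {x \<in> T. g x \<noteq> 0}" using F[of y] by (intro image_eqI[of _ _ "i y"]) auto
  qed (use g in auto)
  then have fin: "finite {y \<in> S. F y \<noteq> 0}" using assms(1) by simp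
  then have "sum' F S = sum F {y \<in> S. F y \<noteq> 0}" by (simp add: sum.G_def)
  also have "\<dots> = sum g {x \<in> T. g x \<noteq> 0}"
    by (rule sum.reindex_bij_witness[where i = j and j = i]) (use g F in auto)
  also have "\<dots> = sum g T"
    using assms(1) by (intro sum.mono_neutral_left) auto
  finally show ?thesis .
qed

context nonroot_cube begin

text \<open>One level is a \<open>burge_sum\<close> with the next chain in place of
  \<open>rtri\<close>. Unfolding runs from N_1 inwards to N_\<nu>, with the cubic sum at the
  core.\<close>

primrec chain :: "nat \<Rightarrow> int \<Rightarrow> int \<Rightarrow> 'a" where
  "chain 0 L M = seed L M"
| "chain (Suc k) L M = (\<Sum>N = 0..M. (q ^ 3) powi tri N * qbin (q ^ 3) L (M - N) * chain k (L - N) N)"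

text \<open>Each level applies the Burge transformation to every \<open>j\<close> separately and
  contributes \<open>tri j\<close>. \<open>J\<close> stays fixed while \<open>L\<close> decreases,
  so that all inner sums share one range of \<open>j\<close> and the summations can be
  exchanged.\<close>

lemma chain_eq_rtri:
  assumes "M \<ge> 0" "L \<le> J"
  shows "chain k L M = (\<Sum>j = -J..J. q powi (3 * (int k + 1) * tri j + j) * rtri (q ^ 3) L M ((int k + 1) * j) j)"
  using assms
proof (induction k arbitrary: L M)
  case 0
  then show ?case by (simp add: seed_eq_rtri)
next
  case (Suc k)
  define a where "a j = q powi (3 * (int k + 1) * tri j + j)" for j
  have "chain (Suc k) L M = (\<Sum>N = 0..M. (q ^ 3) powi tri N * qbin (q ^ 3) L (M - N)
      * (\<Sum>j = -J..J. a j * rtri (q ^ 3) (L - N) N ((int k + 1) * j) j))"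
    unfolding chain.simps a_def using Suc by (intro sum.cong refl arg_cong2[where f = "(*)"] Suc.IH) auto
  also have "\<dots> = (\<Sum>N = 0..M. \<Sum>j = -J..J. a j * ((q ^ 3) powi tri N * qbin (q ^ 3) L (M - N)
      * rtri (q ^ 3) (L - N) N ((int k + 1) * j) j))"
    by (simp add: sum_distrib_left mult_ac)
  also have "\<dots> = (\<Sum>j = -J..J. \<Sum>N = 0..M. a j * ((q ^ 3) powi tri N * qbin (q ^ 3) L (M - N)
      * rtri (q ^ 3) (L - N) N ((int k + 1) * j) j))"
    by (rule sum.swap)
  also have "\<dots> = (\<Sum>j = -J..J. a j * burge_sum (q ^ 3) L M ((int k + 1) * j) j)"
    by (simp add: burge_sum_def sum_distrib_left)
  also have "\<dots> = (\<Sum>j = -J..J. q powi (3 * (int (Suc k) + 1) * tri j + j) * rtri (q ^ 3) L M ((int (Suc k) + 1) * j) j)"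
  proof (rule sum.cong[OF refl])
    fix j
    have "a j * (q ^ 3) powi tri j = q powi (3 * (int (Suc k) + 1) * tri j + j)"
      unfolding a_def pq q.pw_add[symmetric] by (simp add: algebra_simps)
    then show "a j * burge_sum (q ^ 3) L M ((int k + 1) * j) j
       = q powi (3 * (int (Suc k) + 1) * tri j + j) * rtri (q ^ 3) L M ((int (Suc k) + 1) * j) j"
      using p.burge_transform[of "int k + 1" L M j] by (simp add: ac_simps)
  qed
  finally show ?case .
qed

lemma sum_chain_eq:
  "(\<Sum>i = 0..int L. (q ^ 3) powi tri (i - 1) * chain \<nu> i (int L - i))
   = (\<Sum>j = - int L..int L. q powi (3 * int ((\<nu> + 2) choose 2) * j\<^sup>2 + j)
        * qtrinom2 (q ^ 3) L (int (\<nu> + 2) * j) (int (\<nu> + 2) * j))"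
proof -
  define a where "a j = q powi (3 * (int \<nu> + 1) * tri j + j)" for j
  have "(\<Sum>i = 0..int L. (q ^ 3) powi tri (i - 1) * chain \<nu> i (int L - i))
    = (\<Sum>i = 0..int L. (q ^ 3) powi tri (i - 1) * (\<Sum>j = - int L..int L. a j * rtri (q ^ 3) i (int L - i) ((int \<nu> + 1) * j) j))"
    unfolding a_def by (intro sum.cong refl arg_cong2[where f = "(*)"] chain_eq_rtri) auto
  also have "\<dots> = (\<Sum>i = 0..int L. \<Sum>j = - int L..int L. a j * ((q ^ 3) powi tri (i - 1) * rtri (q ^ 3) i (int L - i) ((int \<nu> + 1) * j) j))"
    by (simp add: sum_distrib_left mult_ac)
  also have "\<dots> = (\<Sum>j = - int L..int L. \<Sum>i = 0..int L. a j * ((q ^ 3) powi tri (i - 1) * rtri (q ^ 3) i (int L - i) ((int \<nu> + 1) * j) j))"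
    by (rule sum.swap)
  also have "\<dots> = (\<Sum>j = - int L..int L. a j * dual_sum (q ^ 3) L ((int \<nu> + 1) * j) j)"
    by (simp add: dual_sum_def sum_distrib_left)
  also have "\<dots> = (\<Sum>j = - int L..int L. q powi (3 * int ((\<nu> + 2) choose 2) * j\<^sup>2 + j)
        * qtrinom2 (q ^ 3) L (int (\<nu> + 2) * j) (int (\<nu> + 2) * j))"
  proof (rule sum.cong[OF refl])
    fix j
    have c: "2 * int ((\<nu> + 2) choose 2) = (int \<nu> + 2) * (int \<nu> + 1)"
    proof -
      have "2 * ((\<nu> + 2) choose 2) = (\<nu> + 2) * (\<nu> + 1)"
        unfolding choose_two by simp
      then have "int (2 * ((\<nu> + 2) choose 2)) = int ((\<nu> + 2) * (\<nu> + 1))" by (rule arg_cong)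
      then show ?thesis by (simp only: of_nat_mult of_nat_add of_nat_numeral of_nat_1)
    qed
    \<comment> \<open>The linear parts (\<nu> + 1) j/2 cancel, and the quadratic ones add up to
      (\<nu> + 1)(\<nu> + 2) j^2/2; this is the origin of the binomial coefficient in the
      theorem.\<close>
    have "2 * ((int \<nu> + 1) * tri j + tri ((int \<nu> + 1) * j - 1)) = 2 * (int ((\<nu> + 2) choose 2) * j\<^sup>2)"
    proof -
      have "2 * ((int \<nu> + 1) * tri j + tri ((int \<nu> + 1) * j - 1)) = (int \<nu> + 1) * (2 * tri j) + 2 * tri ((int \<nu> + 1) * j - 1)"
        by (simp add: algebra_simps)
      also have "\<dots> = (2 * int ((\<nu> + 2) choose 2)) * j\<^sup>2"
        unfolding two_tri c by (simp add: algebra_simps power2_eq_square)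
      finally show ?thesis by simp
    qed
    then have e: "(int \<nu> + 1) * tri j + tri ((int \<nu> + 1) * j - 1) = int ((\<nu> + 2) choose 2) * j\<^sup>2"
      by (metis mult_left_cancel zero_neq_numeral)
    have "a j * (q ^ 3) powi tri ((int \<nu> + 1) * j - 1) = q powi (3 * ((int \<nu> + 1) * tri j + tri ((int \<nu> + 1) * j - 1)) + j)"
      unfolding a_def pq q.pw_add[symmetric] by (rule arg_cong[of _ _ "\<lambda>e. q powi e"]) (simp add: algebra_simps)
    then have "a j * (q ^ 3) powi tri ((int \<nu> + 1) * j - 1) = q powi (3 * int ((\<nu> + 2) choose 2) * j\<^sup>2 + j)"
      unfolding e by (simp only: mult.assoc)
    moreover have "(int \<nu> + 1 + 1) * j = int (\<nu> + 2) * j" by simp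
    ultimately show "a j * dual_sum (q ^ 3) L ((int \<nu> + 1) * j) j = q powi (3 * int ((\<nu> + 2) choose 2) * j\<^sup>2 + j)
        * qtrinom2 (q ^ 3) L (int (\<nu> + 2) * j) (int (\<nu> + 2) * j)"
      using p.dual_transform[of "int \<nu> + 1" "int L" j]
      unfolding p.qtrinom2_eq_tsum by (simp only: mult.assoc[symmetric] nat_int)
  qed
  finally show ?thesis .
qed

text \<open>The factor contributed by the step from \<open>N\<^bsub>l-1\<^esub>\<close> to \<open>N\<^sub>l\<close>, where \<open>M\<close> plays the role of \<open>N\<^sub>0\<close>.\<close>

definition link :: "int \<Rightarrow> int \<Rightarrow> (nat \<Rightarrow> nat) \<Rightarrow> nat \<Rightarrow> 'a" where
  "link i M N l = (q ^ 3) powi tri (int (N l))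
     * qbin (q ^ 3) (i - (\<Sum>j = 1..<l. int (N j))) ((if l = 1 then M else int (N (l - 1))) - int (N l))"

text \<open>Partial unfolding to depth \<open>k\<close> is what the induction can extend by one
  variable. The uniform bound \<open>K\<close> replaces the nested ranges: a tuple that increases
  somewhere meets a Gaussian coefficient with a negative argument.\<close>

lemma chain_unfold:
  assumes "k \<le> \<nu>" "0 \<le> M" "M \<le> int K"
  shows "chain \<nu> i M = (\<Sum>N \<in> {1..k} \<rightarrow>\<^sub>E {..K}. (\<Prod>l = 1..k. link i M N l)
     * chain (\<nu> - k) (i - (\<Sum>j = 1..k. int (N j))) (if k = 0 then M else int (N k)))"
  using assms(1)
proof (induction k)
  case 0
  then show ?case by simp
next
  case (Suc k)
  define \<mu> where "\<mu> = \<nu> - Suc k"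
  have \<mu>: "\<nu> - k = Suc \<mu>" using Suc.prems by (simp add: \<mu>_def)
  define G where "G N = (\<Prod>l = 1..Suc k. link i M N l) * chain \<mu> (i - (\<Sum>j = 1..Suc k. int (N j))) (int (N (Suc k)))" for N
  have step: "(\<Prod>l = 1..k. link i M N l)
     * chain (\<nu> - k) (i - (\<Sum>j = 1..k. int (N j))) (if k = 0 then M else int (N k)) = (\<Sum>y\<le>K. G (N(Suc k := y)))"
    if N: "N \<in> {1..k} \<rightarrow>\<^sub>E {..K}" for N
  proof -
    define x where "x = i - (\<Sum>j = 1..k. int (N j))"
    define M' where "M' = (if k = 0 then M else int (N k))"
    have M': "M' \<le> int K" using N assms by (auto simp: M'_def PiE_iff)
    have "chain (\<nu> - k) x M' = (\<Sum>y = 0..M'. (q ^ 3) powi tri y * qbin (q ^ 3) x (M' - y) * chain \<mu> (x - y) y)"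
      unfolding \<mu> by simp
    also have "\<dots> = (\<Sum>y = 0..int K. (q ^ 3) powi tri y * qbin (q ^ 3) x (M' - y) * chain \<mu> (x - y) y)"
      using M' by (intro sum.mono_neutral_left) auto
    also have "\<dots> = (\<Sum>y\<le>K. (q ^ 3) powi tri (int y) * qbin (q ^ 3) x (M' - int y) * chain \<mu> (x - int y) (int y))"
      by (rule sum_atMost_int[symmetric])
    also have "(\<Prod>l = 1..k. link i M N l) * \<dots> = (\<Sum>y\<le>K. G (N(Suc k := y)))"
      unfolding sum_distrib_left
    proof (rule sum.cong[OF refl])
      fix y
      have 1: "(\<Prod>l = 1..k. link i M (N(Suc k := y)) l) = (\<Prod>l = 1..k. link i M N l)"
        by (intro prod.cong refl) (auto simp: link_def intro!: sum.cong)
      have 2: "(\<Sum>j = 1..k. int ((N(Suc k := y)) j)) = (\<Sum>j = 1..k. int (N j))"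
        by (intro sum.cong) auto
      have 3: "link i M (N(Suc k := y)) (Suc k) = (q ^ 3) powi tri (int y) * qbin (q ^ 3) x (M' - int y)"
      proof -
        have "(\<Sum>j = 1..<Suc k. int ((N(Suc k := y)) j)) = (\<Sum>j = 1..k. int (N j))"
          by (intro sum.cong) auto
        then show ?thesis unfolding link_def x_def M'_def by simp
      qed
      show "(\<Prod>l = 1..k. link i M N l) * ((q ^ 3) powi tri (int y) * qbin (q ^ 3) x (M' - int y) * chain \<mu> (x - int y) (int y))
        = G (N(Suc k := y))"
        unfolding G_def using 1 2 3 by (simp add: x_def algebra_simps)
    qed
    finally show ?thesis unfolding x_def M'_def .
  qed
  have ins: "{1..Suc k} = insert (Suc k) {1..k}" by auto
  have "(\<Sum>N \<in> {1..Suc k} \<rightarrow>\<^sub>E {..K}. G N) = (\<Sum>(y, N) \<in> {..K} \<times> ({1..k} \<rightarrow>\<^sub>E {..K}). G (N(Suc k := y)))"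
    unfolding ins PiE_insert_eq
    by (subst sum.reindex[OF inj_combinator]) (auto simp: case_prod_unfold)
  also have "\<dots> = (\<Sum>y\<le>K. \<Sum>N \<in> {1..k} \<rightarrow>\<^sub>E {..K}. G (N(Suc k := y)))"
    by (simp add: sum.cartesian_product)
  also have "\<dots> = (\<Sum>N \<in> {1..k} \<rightarrow>\<^sub>E {..K}. \<Sum>y\<le>K. G (N(Suc k := y)))"
    by (rule sum.swap)
  also have "\<dots> = (\<Sum>N \<in> {1..k} \<rightarrow>\<^sub>E {..K}. (\<Prod>l = 1..k. link i M N l)
     * chain (\<nu> - k) (i - (\<Sum>j = 1..k. int (N j))) (if k = 0 then M else int (N k)))"
    by (intro sum.cong refl step[symmetric])
  also have "\<dots> = chain \<nu> i M"
    using Suc by simp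
  finally show ?case by (simp add: G_def \<mu>_def)
qed

definition seed_term :: "int \<Rightarrow> int \<Rightarrow> int \<Rightarrow> 'a" where
  "seed_term L M t = q powi (tri (L - 2 * t - 1) + 2 * (L - 2 * t) + 3 * t)
     * qbin q (L - 2 * t) (3 * M - (L - 2 * t)) * qbin (q ^ 3) (2 * M) t"

lemma seed_eq_sum:
  assumes "L \<le> int K"
  shows "seed L M = (\<Sum>t\<le>K. seed_term L M (int t))"
proof -
  have "seed L M = (\<Sum>t = 0..int K. seed_term L M t)"
    unfolding seed_def seed_term_def using assms by (intro sum.mono_neutral_left) auto
  then show ?thesis by (simp add: sum_atMost_int)
qed

lemma chain_sum_unfold:
  assumes "\<nu> > 0"
  shows "(\<Sum>i = 0..int L. (q ^ 3) powi tri (i - 1) * chain \<nu> i (int L - i))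
    = (\<Sum>(i, N, t) \<in> {..L} \<times> ({1..\<nu>} \<rightarrow>\<^sub>E {..L}) \<times> {..L}.
        (q ^ 3) powi tri (int i - 1) * (\<Prod>l = 1..\<nu>. link (int i) (int L - int i) N l)
          * seed_term (int i - (\<Sum>j = 1..\<nu>. int (N j))) (int (N \<nu>)) (int t))"
proof -
  have "(\<Sum>i = 0..int L. (q ^ 3) powi tri (i - 1) * chain \<nu> i (int L - i))
     = (\<Sum>i\<le>L. (q ^ 3) powi tri (int i - 1) * chain \<nu> (int i) (int L - int i))"
    by (rule sum_atMost_int[symmetric])
  also have "\<dots> = (\<Sum>i\<le>L. \<Sum>N \<in> {1..\<nu>} \<rightarrow>\<^sub>E {..L}. \<Sum>t\<le>L. (q ^ 3) powi tri (int i - 1) * (\<Prod>l = 1..\<nu>. link (int i) (int L - int i) N l)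
          * seed_term (int i - (\<Sum>j = 1..\<nu>. int (N j))) (int (N \<nu>)) (int t))"
  proof (rule sum.cong[OF refl])
    fix i assume i: "i \<in> {..L}"
    have "chain \<nu> (int i) (int L - int i) = (\<Sum>N \<in> {1..\<nu>} \<rightarrow>\<^sub>E {..L}. (\<Prod>l = 1..\<nu>. link (int i) (int L - int i) N l)
       * seed (int i - (\<Sum>j = 1..\<nu>. int (N j))) (int (N \<nu>)))"
      using chain_unfold[of \<nu> \<nu> "int L - int i" L "int i"] i assms by simp
    also have "\<dots> = (\<Sum>N \<in> {1..\<nu>} \<rightarrow>\<^sub>E {..L}. (\<Prod>l = 1..\<nu>. link (int i) (int L - int i) N l)
       * (\<Sum>t\<le>L. seed_term (int i - (\<Sum>j = 1..\<nu>. int (N j))) (int (N \<nu>)) (int t)))"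
    proof (intro sum.cong refl arg_cong2[where f = "(*)"] seed_eq_sum)
      fix N :: "nat \<Rightarrow> nat"
      have "(\<Sum>j = 1..\<nu>. int (N j)) \<ge> 0" by (simp add: sum_nonneg)
      then show "int i - (\<Sum>j = 1..\<nu>. int (N j)) \<le> int L" using i by simp
    qed
    finally show "(q ^ 3) powi tri (int i - 1) * chain \<nu> (int i) (int L - int i)
      = (\<Sum>N \<in> {1..\<nu>} \<rightarrow>\<^sub>E {..L}. \<Sum>t\<le>L. (q ^ 3) powi tri (int i - 1) * (\<Prod>l = 1..\<nu>. link (int i) (int L - int i) N l)
          * seed_term (int i - (\<Sum>j = 1..\<nu>. int (N j))) (int (N \<nu>)) (int t))"
      by (simp add: sum_distrib_left mult.assoc)
  qed
  finally show ?thesis by (simp add: sum.cartesian_product)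
qed

end

section \<open>The multisum\<close>

definition multisum_term :: "'a::field \<Rightarrow> nat \<Rightarrow> nat \<Rightarrow> nat \<times> nat \<times> (nat \<Rightarrow> nat) \<Rightarrow> 'a" where
  "multisum_term q \<nu> L = (\<lambda>(i, m, n). let N = tail_sum \<nu> n in
        q ^ ((m\<^sup>2 + 3 * (i\<^sup>2 + (\<Sum>k = 1..\<nu>. (N k)\<^sup>2))) div 2)
        * qbinom (q ^ 3) (int L - int (N 1)) (int i)
        * qbinom q (3 * int (n \<nu>)) (int m)
        * qbinom (q ^ 3)
            (2 * int (n \<nu>) + (int i - (\<Sum>k = 1..\<nu>. int (N k)) - int m) div 2)
            (2 * int (n \<nu>))
        * (\<Prod>j = 1..\<nu> - 1.
             qbinom (q ^ 3) (int i - (\<Sum>k = 1..j. int (N k)) + int (n j)) (int (n j))))"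

lemma tail_sum_rec: "k \<le> \<nu> \<Longrightarrow> tail_sum \<nu> n k = n k + tail_sum \<nu> n (Suc k)"
  unfolding tail_sum_def by (rule sum.atLeast_Suc_atMost)

lemma tail_sum_beyond: "tail_sum \<nu> n (Suc \<nu>) = 0"
  by (simp add: tail_sum_def)

lemma tail_sum_eqI:
  assumes "k \<le> \<nu>" "n \<nu> = N \<nu>" "\<And>j. j \<in> {k..<\<nu>} \<Longrightarrow> N j = n j + N (Suc j)"
  shows "tail_sum \<nu> n k = N k"
  using assms
proof (induction k rule: inc_induct)
  case base
  then show ?case by (simp add: tail_sum_def)
next
  case (step k)
  then have "tail_sum \<nu> n (Suc k) = N (Suc k)" by simp
  then show ?case using step by (simp add: tail_sum_rec)
qed

context nonroot begin

lemma prod_powi: "(\<Prod>l\<in>A. p powi f l) = p powi (\<Sum>l\<in>A. f l)"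
  by (induction A rule: infinite_finite_induct) (simp_all add: pw_add)

end

context nonroot_cube begin

definition linked_term :: "nat \<Rightarrow> nat \<Rightarrow> nat \<times> (nat \<Rightarrow> nat) \<times> nat \<Rightarrow> 'a" where
  "linked_term \<nu> L = (\<lambda>(i, N, t). (q ^ 3) powi tri (int i - 1) * (\<Prod>l = 1..\<nu>. link (int i) (int L - int i) N l)
          * seed_term (int i - (\<Sum>j = 1..\<nu>. int (N j))) (int (N \<nu>)) (int t))"

text \<open>Twice the exponent collected on the right is m^2 + 3 (i^2 + sum of the N_k^2) plus 3
  (N_1 + ... + N_\<nu> + m + 2 t - i). The hypothesis on \<open>i\<close> removes the excess and
  also makes the division by 2 exact.\<close>

lemma multisum_term_eq_linked_term:
  assumes "\<nu> > 0"
    and N: "\<And>k. k \<in> {1..\<nu>} \<Longrightarrow> tail_sum \<nu> n k = N k"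
    and i: "int i = (\<Sum>k = 1..\<nu>. int (N k)) + int m + 2 * int t"
  shows "multisum_term q \<nu> L (i, m, n) = linked_term \<nu> L (i, N, t)"
proof -
  define S where "S = (\<Sum>k = 1..\<nu>. int (N k))"
  define B where "B l = qbin (q ^ 3) (int i - (\<Sum>j = 1..<l. int (N j))) ((if l = 1 then int L - int i else int (N (l - 1))) - int (N l))" for l
  have n: "int (n j) = int (N j) - int (N (Suc j))" if "j \<in> {1..\<nu> - 1}" for j
  proof -
    have "1 \<le> j" "Suc j \<le> \<nu>" using that assms(1) by auto
    then show ?thesis using N[of j] N[of "Suc j"] tail_sum_rec[of j \<nu> n] by simp
  qed
  have n\<nu>: "n \<nu> = N \<nu>"
    using N[of \<nu>] tail_sum_rec[of \<nu> \<nu> n] tail_sum_beyond[of \<nu> n] assms(1) by simp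
  have exponent: "q ^ ((m\<^sup>2 + 3 * (i\<^sup>2 + (\<Sum>k = 1..\<nu>. (N k)\<^sup>2))) div 2)
     = (q ^ 3) powi tri (int i - 1) * (q ^ 3) powi (\<Sum>l = 1..\<nu>. tri (int (N l))) * q powi (tri (int m - 1) + 2 * int m + 3 * int t)"
  proof -
    define e where "e = 3 * (tri (int i - 1) + (\<Sum>l = 1..\<nu>. tri (int (N l)))) + (tri (int m - 1) + 2 * int m + 3 * int t)"
    have "2 * (\<Sum>l = 1..\<nu>. tri (int (N l))) = (\<Sum>l = 1..\<nu>. (int (N l))\<^sup>2) + S"
      unfolding sum_distrib_left two_tri S_def by (simp add: algebra_simps power2_eq_square sum.distrib)
    then have "2 * e = 3 * ((2 * tri (int i - 1)) + (\<Sum>l = 1..\<nu>. (int (N l))\<^sup>2) + S) + (2 * tri (int m - 1) + 4 * int m + 6 * int t)"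
      by (simp add: e_def)
    also have "\<dots> = (int m)\<^sup>2 + 3 * ((int i)\<^sup>2 + (\<Sum>l = 1..\<nu>. (int (N l))\<^sup>2)) + 3 * (S + int m + 2 * int t - int i)"
      unfolding two_tri by (simp add: algebra_simps power2_eq_square)
    also have "\<dots> = int (m\<^sup>2 + 3 * (i\<^sup>2 + (\<Sum>k = 1..\<nu>. (N k)\<^sup>2)))"
      using i by (simp add: S_def)
    finally have "int ((m\<^sup>2 + 3 * (i\<^sup>2 + (\<Sum>k = 1..\<nu>. (N k)\<^sup>2))) div 2) = e"
      by (metis nonzero_mult_div_cancel_left of_nat_numeral zdiv_int zero_neq_numeral)
    then have "q ^ ((m\<^sup>2 + 3 * (i\<^sup>2 + (\<Sum>k = 1..\<nu>. (N k)\<^sup>2))) div 2) = q powi e"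
      by (metis power_int_of_nat)
    also have "e = 3 * tri (int i - 1) + 3 * (\<Sum>l = 1..\<nu>. tri (int (N l))) + (tri (int m - 1) + 2 * int m + 3 * int t)"
      by (simp add: e_def)
    finally show ?thesis unfolding pq q.pw_add[symmetric] .
  qed
  \<comment> \<open>An index shift: the first link gives the coefficient with top L - N_1, and link
    \<open>j + 1\<close> gives factor \<open>j\<close> of the product, which therefore ends at
    \<open>\<nu> - 1\<close>.\<close>
  have "{1..\<nu>} = insert 1 {Suc 1..Suc (\<nu> - 1)}" using assms(1) by auto
  then have "(\<Prod>l = 1..\<nu>. B l) = B 1 * (\<Prod>j = Suc 1..Suc (\<nu> - 1). B j)"
    by (metis atLeastAtMost_iff finite_atLeastAtMost not_less_eq_eq order_refl prod.insert)
  also have "(\<Prod>j = Suc 1..Suc (\<nu> - 1). B j) = (\<Prod>j = 1..\<nu> - 1. B (Suc j))"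
    by (rule prod.shift_bounds_cl_Suc_ivl)
  also have "B 1 = qbinom (q ^ 3) (int L - int (N 1)) (int i)"
    unfolding B_def qbinom_eq_qbin using qbin_commute by (simp add: algebra_simps)
  also have "(\<Prod>j = 1..\<nu> - 1. B (Suc j)) = (\<Prod>j = 1..\<nu> - 1.
             qbinom (q ^ 3) (int i - (\<Sum>k = 1..j. int (N k)) + int (n j)) (int (n j)))"
  proof (rule prod.cong[OF refl])
    fix j assume j: "j \<in> {1..\<nu> - 1}"
    have "{1..<Suc j} = {1..j}" by auto
    then show "B (Suc j) = qbinom (q ^ 3) (int i - (\<Sum>k = 1..j. int (N k)) + int (n j)) (int (n j))"
      using j unfolding B_def qbinom_eq_qbin n[OF j] by simp
  qed
  finally have B: "(\<Prod>l = 1..\<nu>. B l) = qbinom (q ^ 3) (int L - int (N 1)) (int i) * (\<Prod>j = 1..\<nu> - 1.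
             qbinom (q ^ 3) (int i - (\<Sum>k = 1..j. int (N k)) + int (n j)) (int (n j)))" .
  have sums: "(\<Sum>k = 1..\<nu>. (tail_sum \<nu> n k)\<^sup>2) = (\<Sum>k = 1..\<nu>. (N k)\<^sup>2)"
    "(\<Sum>k = 1..\<nu>. int (tail_sum \<nu> n k)) = S"
    unfolding S_def by (intro sum.cong refl; simp add: N)+
  have prods: "(\<Prod>j = 1..\<nu> - 1. qbinom (q ^ 3) (int i - (\<Sum>k = 1..j. int (tail_sum \<nu> n k)) + int (n j)) (int (n j)))
      = (\<Prod>j = 1..\<nu> - 1. qbinom (q ^ 3) (int i - (\<Sum>k = 1..j. int (N k)) + int (n j)) (int (n j)))"
  proof (rule prod.cong[OF refl])
    fix j assume j: "j \<in> {1..\<nu> - 1}"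
    have "(\<Sum>k = 1..j. int (tail_sum \<nu> n k)) = (\<Sum>k = 1..j. int (N k))"
      using j by (intro sum.cong refl) (auto simp: N)
    then show "qbinom (q ^ 3) (int i - (\<Sum>k = 1..j. int (tail_sum \<nu> n k)) + int (n j)) (int (n j))
      = qbinom (q ^ 3) (int i - (\<Sum>k = 1..j. int (N k)) + int (n j)) (int (n j))" by simp
  qed
  have t: "(int i - S - int m) div 2 = int t" "int i - S - 2 * int t = int m"
    using i by (simp_all add: S_def)
  have seed: "seed_term (int i - S) (int (N \<nu>)) (int t) = q powi (tri (int m - 1) + 2 * int m + 3 * int t)
      * qbinom q (3 * int (N \<nu>)) (int m) * qbinom (q ^ 3) (2 * int (N \<nu>) + int t) (2 * int (N \<nu>))"
    unfolding seed_term_def t qbinom_eq_qbin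
    using qbin_commute[of q "int m"] qbin_commute[of "q ^ 3" "2 * int (N \<nu>)"] by simp
  have "multisum_term q \<nu> L (i, m, n) = q ^ ((m\<^sup>2 + 3 * (i\<^sup>2 + (\<Sum>k = 1..\<nu>. (N k)\<^sup>2))) div 2)
      * (\<Prod>l = 1..\<nu>. B l)
      * (qbinom q (3 * int (N \<nu>)) (int m) * qbinom (q ^ 3) (2 * int (N \<nu>) + int t) (2 * int (N \<nu>)))"
    unfolding multisum_term_def Let_def prod.case sums prods B n\<nu> t using N[of 1] assms(1) by (simp add: mult_ac)
  also have "\<dots> = (q ^ 3) powi tri (int i - 1) * ((q ^ 3) powi (\<Sum>l = 1..\<nu>. tri (int (N l))) * (\<Prod>l = 1..\<nu>. B l))
      * seed_term (int i - S) (int (N \<nu>)) (int t)"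
    unfolding exponent seed by (simp only: mult_ac)
  also have "(q ^ 3) powi (\<Sum>l = 1..\<nu>. tri (int (N l))) * (\<Prod>l = 1..\<nu>. B l) = (\<Prod>l = 1..\<nu>. link (int i) (int L - int i) N l)"
    unfolding link_def prod.distrib p.prod_powi B_def ..
  finally show ?thesis by (simp add: linked_term_def S_def)
qed

lemma multisum_eq_sum_chain:
  assumes "\<nu> > 0"
  shows "sum' (multisum_term q \<nu> L)
      {(i, m, n). n \<in> {1..\<nu>} \<rightarrow>\<^sub>E UNIV \<and> [i + m = (\<Sum>k = 1..\<nu>. tail_sum \<nu> n k)] (mod 2)}
    = (\<Sum>i = 0..int L. (q ^ 3) powi tri (i - 1) * chain \<nu> i (int L - i))"
proof -
  \<comment> \<open>The inverse of forming tail sums. Truncated subtraction is harmless, since a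
    nonzero term forces \<open>N\<close> to be decreasing (\<open>dec\<close> below).\<close>
  define d where "d N = (\<lambda>k\<in>{1..\<nu>}. if k = \<nu> then N \<nu> else N k - N (Suc k))" for N :: "nat \<Rightarrow> nat"
  define J where "J = (\<lambda>(i, N, t). (i, nat (int i - (\<Sum>k = 1..\<nu>. int (N k)) - 2 * int t), d N))"
  define I where "I = (\<lambda>(i, m, n). (i, (\<lambda>k\<in>{1..\<nu>}. tail_sum \<nu> n k), nat ((int i - (\<Sum>k = 1..\<nu>. int (tail_sum \<nu> n k)) - int m) div 2)))"
  have "sum' (multisum_term q \<nu> L)
      {(i, m, n). n \<in> {1..\<nu>} \<rightarrow>\<^sub>E UNIV \<and> [i + m = (\<Sum>k = 1..\<nu>. tail_sum \<nu> n k)] (mod 2)}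
    = sum (linked_term \<nu> L) ({..L} \<times> ({1..\<nu>} \<rightarrow>\<^sub>E {..L}) \<times> {..L})"
  proof (rule sum'_reindex_support[where i = I and j = J])
    show "finite ({..L} \<times> ({1..\<nu>} \<rightarrow>\<^sub>E {..L}) \<times> {..L})"
      by (intro finite_cartesian_product finite_PiE) auto
  next
    fix x assume x: "x \<in> {..L} \<times> ({1..\<nu>} \<rightarrow>\<^sub>E {..L}) \<times> {..L}" "linked_term \<nu> L x \<noteq> 0"
    obtain i N t where x': "x = (i, N, t)" by (cases x)
    have N: "N \<in> {1..\<nu>} \<rightarrow>\<^sub>E {..L}" using x x' by simp
    define S where "S = (\<Sum>k = 1..\<nu>. int (N k))"
    define m where "m = nat (int i - S - 2 * int t)"
    have m: "int i = S + int m + 2 * int t"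
    proof -
      have "qbin q (int i - S - 2 * int t) (3 * int (N \<nu>) - (int i - S - 2 * int t)) \<noteq> 0"
        using x(2) unfolding x' linked_term_def seed_term_def S_def by auto
      then have "int i - S - 2 * int t \<ge> 0" by (metis qbin_neg(1) not_less)
      then show ?thesis by (simp add: m_def)
    qed
    have dec: "N (Suc j) \<le> N j" if "j \<in> {1..<\<nu>}" for j
    proof -
      have "link (int i) (int L - int i) N (Suc j) \<noteq> 0"
        using x(2) that unfolding x' linked_term_def by auto
      then have "qbin (q ^ 3) (int i - (\<Sum>j = 1..<Suc j. int (N j))) (int (N j) - int (N (Suc j))) \<noteq> 0"
        using that unfolding link_def by auto
      then have "int (N j) - int (N (Suc j)) \<ge> 0" by (metis qbin_neg(2) not_less)
      then show ?thesis by simp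
    qed
    have tail: "tail_sum \<nu> (d N) k = N k" if "k \<in> {1..\<nu>}" for k
      by (rule tail_sum_eqI) (use that dec in \<open>auto simp: d_def\<close>)
    have Jx: "J x = (i, m, d N)" unfolding J_def x' m_def S_def by simp
    have "int (i + m) = int ((\<Sum>k = 1..\<nu>. tail_sum \<nu> (d N) k) + 2 * (m + t))"
      using m by (simp add: tail S_def)
    then have "i + m = (\<Sum>k = 1..\<nu>. tail_sum \<nu> (d N) k) + 2 * (m + t)"
      by (simp only: of_nat_eq_iff)
    then have "[i + m = (\<Sum>k = 1..\<nu>. tail_sum \<nu> (d N) k)] (mod 2)"
      by (simp add: cong_def)
    moreover have "I (J x) = x"
    proof -
      have "(\<lambda>k\<in>{1..\<nu>}. tail_sum \<nu> (d N) k) = N"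
        using N by (intro ext) (auto simp: tail PiE_iff extensional_def)
      moreover have "(\<Sum>k = 1..\<nu>. int (tail_sum \<nu> (d N) k)) = S"
        by (simp add: tail S_def)
      ultimately show ?thesis using m unfolding Jx unfolding I_def x' by simp
    qed
    moreover have "multisum_term q \<nu> L (J x) = linked_term \<nu> L x"
      unfolding Jx unfolding x' using assms tail m unfolding S_def by (rule multisum_term_eq_linked_term)
    ultimately show "J x \<in> {(i, m, n). n \<in> {1..\<nu>} \<rightarrow>\<^sub>E UNIV \<and> [i + m = (\<Sum>k = 1..\<nu>. tail_sum \<nu> n k)] (mod 2)}
        \<and> I (J x) = x \<and> multisum_term q \<nu> L (J x) = linked_term \<nu> L x"
      by (simp add: Jx d_def)
  next
    fix y assume y: "y \<in> {(i, m, n). n \<in> {1..\<nu>} \<rightarrow>\<^sub>E UNIV \<and> [i + m = (\<Sum>k = 1..\<nu>. tail_sum \<nu> n k)] (mod 2)}"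
      "multisum_term q \<nu> L y \<noteq> 0"
    obtain i m n where y': "y = (i, m, n)" by (cases y)
    have n: "n \<in> {1..\<nu>} \<rightarrow>\<^sub>E UNIV" and cong: "[i + m = (\<Sum>k = 1..\<nu>. tail_sum \<nu> n k)] (mod 2)"
      using y(1) y' by auto
    define N where "N = (\<lambda>k\<in>{1..\<nu>}. tail_sum \<nu> n k)"
    have N: "tail_sum \<nu> n k = N k" if "k \<in> {1..\<nu>}" for k using that by (simp add: N_def)
    define S where "S = (\<Sum>k = 1..\<nu>. int (N k))"
    have S: "(\<Sum>k = 1..\<nu>. int (tail_sum \<nu> n k)) = S" unfolding S_def by (intro sum.cong refl) (simp add: N)
    define t where "t = nat ((int i - S - int m) div 2)"
    have "qbinom (q ^ 3) (2 * int (n \<nu>) + (int i - S - int m) div 2) (2 * int (n \<nu>)) \<noteq> 0"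
      "qbinom (q ^ 3) (int L - int (tail_sum \<nu> n 1)) (int i) \<noteq> 0"
      using y(2) unfolding y' multisum_term_def Let_def prod.case S by auto
    \<comment> \<open>The last Gaussian coefficient is nonzero only if the halved difference is
      nonnegative; parity then shows that \<open>div 2\<close> did not round.\<close>
    then have t0: "(int i - S - int m) div 2 \<ge> 0" and L: "tail_sum \<nu> n 1 + i \<le> L"
      by (auto simp: qbinom_def split: if_splits)
    have "even (int i - S - int m)"
    proof -
      have "even (int (i + m) - int (\<Sum>k = 1..\<nu>. tail_sum \<nu> n k))"
        using cong by (metis cong_iff_dvd_diff cong_int_iff of_nat_numeral)
      then show ?thesis using S by auto
    qed
    then have i: "int i = S + int m + 2 * int t"
      using t0 by (auto simp: t_def)
    have "tail_sum \<nu> n k \<le> L" if "k \<in> {1..\<nu>}" for k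
    proof -
      have "tail_sum \<nu> n k \<le> tail_sum \<nu> n 1"
        unfolding tail_sum_def by (rule sum_mono2) (use that in auto)
      then show ?thesis using L by simp
    qed
    moreover have "t \<le> L"
    proof -
      have "S \<ge> 0" unfolding S_def by (simp add: sum_nonneg)
      then show ?thesis using i L by linarith
    qed
    moreover have Iy: "I y = (i, N, t)" unfolding I_def y' N_def[symmetric] t_def prod.case S ..
    moreover have "d N = n"
    proof
      fix k
      show "d N k = n k"
      proof (cases "k \<in> {1..\<nu>}")
        case True
        then show ?thesis
          using tail_sum_rec[of k \<nu> n] tail_sum_beyond[of \<nu> n] by (auto simp: d_def N_def)
      next
        case False
        then show ?thesis using n by (auto simp: d_def PiE_iff extensional_def)
      qed
    qed
    then have "J (I y) = y"
      using i unfolding Iy unfolding J_def y' prod.case S_def[symmetric] by simp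
    moreover have "linked_term \<nu> L (I y) = multisum_term q \<nu> L y"
      unfolding Iy unfolding y' using assms N i unfolding S_def by (rule multisum_term_eq_linked_term[symmetric])
    ultimately show "I y \<in> {..L} \<times> ({1..\<nu>} \<rightarrow>\<^sub>E {..L}) \<times> {..L} \<and> J (I y) = y \<and> linked_term \<nu> L (I y) = multisum_term q \<nu> L y"
      using L by (auto simp: N_def)
  qed
  then show ?thesis
    unfolding chain_sum_unfold[OF assms] linked_term_def .
qed

lemma sum'_qtrinom2_eq:
  assumes "c > 0"
  shows "sum' (\<lambda>j::int. f j * qtrinom2 (q ^ 3) L (c * j) (c * j)) UNIV
    = (\<Sum>j = - int L..int L. f j * qtrinom2 (q ^ 3) L (c * j) (c * j))"
proof -
  have "qtrinom2 (q ^ 3) L (c * j) (c * j) = 0" if "j \<notin> {- int L..int L}" for j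
  proof -
    have "\<bar>j\<bar> \<le> c * \<bar>j\<bar>" using assms mult_right_mono[of 1 c "\<bar>j\<bar>"] by simp
    moreover have "int L < \<bar>j\<bar>" using that by auto
    ultimately have "tsum (q ^ 3) (int L) (c * \<bar>j\<bar>) = 0" by (intro tsum_eq_0) linarith
    then show ?thesis
      unfolding p.qtrinom2_eq_tsum using p.tsum_uminus[of "int L" "c * j"] by (cases "j \<ge> 0") auto
  qed
  then have "sum' (\<lambda>j::int. f j * qtrinom2 (q ^ 3) L (c * j) (c * j)) UNIV
    = sum' (\<lambda>j::int. f j * qtrinom2 (q ^ 3) L (c * j) (c * j)) {- int L..int L}"
    by (intro sum.mono_neutral_right') auto
  then show ?thesis by simp
qed

end

section \<open>The degenerate base zero\<close>

lemma qpoch_0_base: "qpoch 0 n = 1"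
  unfolding qpoch_def by (rule prod.neutral) auto

text \<open>The hypothesis of the theorem admits \<open>q = 0\<close>, where negative powers are junk; both sides are then \<open>1\<close>.\<close>

lemma multisum_base_0:
  assumes "\<nu> > 0"
  shows "sum' (multisum_term (0::'a::field) \<nu> L)
      {(i, m, n). n \<in> {1..\<nu>} \<rightarrow>\<^sub>E UNIV \<and> [i + m = (\<Sum>k = 1..\<nu>. tail_sum \<nu> n k)] (mod 2)} = 1"
proof -
  define zs where "zs = (\<lambda>k\<in>{1..\<nu>}. 0::nat)"
  define z where "z = (0::nat, 0::nat, zs)"
  have zs: "zs k = 0" if "k \<in> {1..\<nu>}" for k
    unfolding zs_def using that by simp
  have tail: "tail_sum \<nu> zs k = 0" if "k \<ge> 1" for k
    unfolding tail_sum_def by (rule sum.neutral) (use that zs in auto)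
  have z: "multisum_term (0::'a) \<nu> L z = 1"
  proof -
    have 1: "(\<Sum>k = 1..j. int (tail_sum \<nu> zs k)) = 0" for j
      by (rule sum.neutral) (simp add: tail)
    have 2: "(\<Sum>k = 1..\<nu>. (tail_sum \<nu> zs k)\<^sup>2) = 0"
      by (rule sum.neutral) (simp add: tail)
    have 3: "(\<Prod>j = 1..\<nu> - 1. qbinom ((0::'a) ^ 3) (int 0 - 0 + int (zs j)) (int (zs j))) = 1"
      by (rule prod.neutral) (auto simp: zs qbinom_def)
    show ?thesis
      unfolding multisum_term_def z_def Let_def prod.case 1 2 3
      using tail[of 1] zs[of \<nu>] assms by (simp add: qbinom_def qpoch_0_base)
  qed
  have "sum' (multisum_term (0::'a) \<nu> L)
      {(i, m, n). n \<in> {1..\<nu>} \<rightarrow>\<^sub>E UNIV \<and> [i + m = (\<Sum>k = 1..\<nu>. tail_sum \<nu> n k)] (mod 2)}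
    = (\<Sum>x\<in>{()}. 1)"
  proof (rule sum'_reindex_support[where j = "\<lambda>_. z" and i = "\<lambda>_. ()"])
    fix y assume y: "y \<in> {(i, m, n). n \<in> {1..\<nu>} \<rightarrow>\<^sub>E UNIV \<and> [i + m = (\<Sum>k = 1..\<nu>. tail_sum \<nu> n k)] (mod 2)}"
      "multisum_term (0::'a) \<nu> L y \<noteq> 0"
    obtain i m n where y': "y = (i, m, n)" by (cases y)
    have "(m\<^sup>2 + 3 * (i\<^sup>2 + (\<Sum>k = 1..\<nu>. (tail_sum \<nu> n k)\<^sup>2))) div 2 = 0"
      and m: "qbinom (0::'a) (3 * int (n \<nu>)) (int m) \<noteq> 0"
      using y(2) unfolding y' multisum_term_def Let_def prod.case by (auto simp: power_0_left split: if_splits)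
    then have "m\<^sup>2 + 3 * (i\<^sup>2 + (\<Sum>k = 1..\<nu>. (tail_sum \<nu> n k)\<^sup>2)) < 2" by linarith
    moreover have "a + 3 * (b + c) < 2 \<Longrightarrow> b = 0 \<and> c = 0" for a b c :: nat by arith
    ultimately have i: "i\<^sup>2 = 0" and s: "(\<Sum>k = 1..\<nu>. (tail_sum \<nu> n k)\<^sup>2) = 0" by blast+
    have n: "n k = 0" if "k \<in> {1..\<nu>}" for k
    proof -
      have "tail_sum \<nu> n k = 0" using s that by simp
      then show ?thesis using that tail_sum_rec[of k \<nu> n] by simp
    qed
    \<comment> \<open>The rounded exponent is also zero at \<open>m = 1\<close>; this value is
      excluded by the coefficient with top \<open>3 * n \<nu> = 0\<close>.\<close>
    then have "m = 0" using m assms by (auto simp: qbinom_def split: if_splits)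
    moreover have "n = zs"
      using y(1) n by (intro ext) (auto simp: zs_def y' PiE_iff extensional_def)
    ultimately show "() \<in> {()} \<and> z = y \<and> (1::'a) = multisum_term 0 \<nu> L y"
      using i z by (auto simp: z_def y')
  next
    have "(\<Sum>k = 1..\<nu>. tail_sum \<nu> zs k) = 0"
      by (rule sum.neutral) (simp add: tail)
    then have "[0 + 0 = (\<Sum>k = 1..\<nu>. tail_sum \<nu> zs k)] (mod 2)" by simp
    moreover have "zs \<in> {1..\<nu>} \<rightarrow>\<^sub>E UNIV" by (simp add: zs_def)
    ultimately show "z \<in> {(i, m, n). n \<in> {1..\<nu>} \<rightarrow>\<^sub>E UNIV \<and> [i + m = (\<Sum>k = 1..\<nu>. tail_sum \<nu> n k)] (mod 2)}
      \<and> () = x \<and> multisum_term 0 \<nu> L z = (1::'a)" if "x \<in> {()}" for x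
      using that z unfolding z_def by simp
  qed auto
  then show ?thesis by simp
qed

lemma qtrinom2_base_0: "qtrinom2 (0::'a::field) L 0 0 = 1"
proof -
  have "qtrinom2 (0::'a) L 0 0 = (\<Sum>x\<in>{()}. 1)"
    unfolding qtrinom2_def
    by (rule sum'_reindex_support[where j = "\<lambda>_. 0" and i = "\<lambda>_. ()"])
      (auto simp: inv_qpoch_def qpoch_0_base power_int_0_left_if split: if_splits)
  then show ?thesis by simp
qed

text \<open>A nonzero power of 0, even a negative one, is 0, so only zeros of j (a j + 1)
  contribute. For \<open>a \<ge> 2\<close> that leaves \<open>j = 0\<close>, whereas
  \<open>a = 1\<close> would admit \<open>j = -1\<close> as well.\<close>

lemma qtrinom2_sum_base_0:
  assumes "a \<ge> 2"
  shows "sum' (\<lambda>j::int. (0::'a::field) powi (a * j\<^sup>2 + j) * qtrinom2 0 L (c * j) (c * j)) UNIV = 1"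
proof -
  have nz: "j = 0" if "a * j\<^sup>2 + j = 0" for j
  proof (rule ccontr)
    assume "j \<noteq> 0"
    then have "a * \<bar>j\<bar> \<ge> 2 * 1" using assms by (intro mult_mono) auto
    then have "a * j + 1 \<noteq> 0" by (cases "j \<ge> 0") auto
    then have "j * (a * j + 1) \<noteq> 0" using \<open>j \<noteq> 0\<close> by simp
    then show False using that by (simp add: algebra_simps power2_eq_square)
  qed
  have "sum' (\<lambda>j::int. (0::'a) powi (a * j\<^sup>2 + j) * qtrinom2 0 L (c * j) (c * j)) UNIV = (\<Sum>x\<in>{()}. 1)"
    by (rule sum'_reindex_support[where j = "\<lambda>_. 0" and i = "\<lambda>_. ()"])
      (auto simp: qtrinom2_base_0 power_int_0_left_if split: if_splits dest!: nz)
  then show ?thesis by simp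
qed

theorem theorem6p4:
  fixes q :: "'a::field" and \<nu> L :: nat
  assumes "\<nu> > 0"
    and "\<And>n. n > 0 \<Longrightarrow> q ^ n \<noteq> 1"
  shows
    "sum' (\<lambda>(i::nat, m::nat, n::nat \<Rightarrow> nat). let N = tail_sum \<nu> n in
        q ^ ((m\<^sup>2 + 3 * (i\<^sup>2 + (\<Sum>k = 1..\<nu>. (N k)\<^sup>2))) div 2)
        * qbinom (q ^ 3) (int L - int (N 1)) (int i)
        * qbinom q (3 * int (n \<nu>)) (int m)
        * qbinom (q ^ 3)
            (2 * int (n \<nu>) + (int i - (\<Sum>k = 1..\<nu>. int (N k)) - int m) div 2)
            (2 * int (n \<nu>))
        * (\<Prod>j = 1..\<nu> - 1.
             qbinom (q ^ 3) (int i - (\<Sum>k = 1..j. int (N k)) + int (n j)) (int (n j))))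
      {(i, m, n). n \<in> {1..\<nu>} \<rightarrow>\<^sub>E UNIV \<and> [i + m = (\<Sum>k = 1..\<nu>. tail_sum \<nu> n k)] (mod 2)}
     = sum' (\<lambda>j::int. q powi (3 * int ((\<nu> + 2) choose 2) * j\<^sup>2 + j)
              * qtrinom2 (q ^ 3) L (int (\<nu> + 2) * j) (int (\<nu> + 2) * j)) UNIV"
  unfolding multisum_term_def[symmetric]
proof (cases "q = 0")
  case True
  have "(\<nu> + 2) choose 2 \<ge> 1" by (simp add: Suc_le_eq zero_less_binomial)
  then have "3 * int ((\<nu> + 2) choose 2) \<ge> 2" by linarith
  then show "sum' (multisum_term q \<nu> L)
      {(i, m, n). n \<in> {1..\<nu>} \<rightarrow>\<^sub>E UNIV \<and> [i + m = (\<Sum>k = 1..\<nu>. tail_sum \<nu> n k)] (mod 2)}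
     = sum' (\<lambda>j::int. q powi (3 * int ((\<nu> + 2) choose 2) * j\<^sup>2 + j)
              * qtrinom2 (q ^ 3) L (int (\<nu> + 2) * j) (int (\<nu> + 2) * j)) UNIV"
    unfolding True power_zero_numeral multisum_base_0[OF assms(1)]
    by (rule qtrinom2_sum_base_0[symmetric])
next
  case False
  interpret nonroot_cube q
    by unfold_locales (use False assms(2) in auto)
  show "sum' (multisum_term q \<nu> L)
      {(i, m, n). n \<in> {1..\<nu>} \<rightarrow>\<^sub>E UNIV \<and> [i + m = (\<Sum>k = 1..\<nu>. tail_sum \<nu> n k)] (mod 2)}
     = sum' (\<lambda>j::int. q powi (3 * int ((\<nu> + 2) choose 2) * j\<^sup>2 + j)
              * qtrinom2 (q ^ 3) L (int (\<nu> + 2) * j) (int (\<nu> + 2) * j)) UNIV"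
    unfolding multisum_eq_sum_chain[OF assms(1)] sum_chain_eq
    by (rule sum'_qtrinom2_eq[symmetric]) simp
qed

end
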